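(* Let $K=K_1\cup\dots\cup K_s\subset\mathbb{R}^N$ ($N\ge 2$, $s\ge 3$) be an open billiard configuration, let $\Sigma$ be its symbol space with left shift $\sigma$, and let $\phi:\Sigma\to\mathbb{R}^N$ be the observable assigning to $\xi$ the starting point $y\in\partial K_{\xi_0}$ of the billiard trajectory coded by $\xi$. Then the general rotation set $G_\phi$ is convex, and the set $P_\phi$ of all convex combinations of rotation vectors of periodic elements of $\Sigma$ is dense in $G_\phi$.
   Context: An open billiard configuration: $K_1,\dots,K_s$ are pairwise disjoint compact strictly convex subsets of $\mathbb{R}^N$ with $C^2$-smooth boundaries, satisfying the no-eclipse condition: for any pairwise distinct $i,j,k$, the convex hull of $K_i\cup K_j$ does not intersect $K_k$. The billiard takes place in $\Omega=\mathbb{R}^N\setminus K$, with specular reflection at $\partial K$. The symbol space $\Sigma$ is the set of bi-infinite sequences $\xi=(\xi_i)_{i\in\mathbb{Z}}$ with $\xi_i\in\{1,\dots,s\}$ and $\xi_i\neq\xi_{i+1}$ for all $i$; $\sigma$ is the left shift $(\sigma\xi)_i=\xi_{i+1}$. For each $\xi\in\Sigma$ there is a unique pair $(y,v)$, $y\in\partial K$, $v$ a unit vector, such that the billiard trajectory issued from $y$ in direction $v$ has infinitely many reflections forwards and backwards and its $i$-th reflection is at $\partial K_{\xi_i}$ for every $i\in\mathbb{Z}$ (the $0$-th being at $y$); define $\phi(\xi)=y$. For $\xi\in\Sigma$, the rotation vector is $\rho_\phi(\xi)=\lim_{n\to\infty}\frac1n\sum_{i=0}^{n-1}\phi(\sigma^i\xi)$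 when this limit exists. The general rotation set $G_\phi$ is the set of all limits of convergent subsequences of the sequences $\big(\frac1n\sum_{i=0}^{n-1}\phi(\sigma^i\xi)\big)_{n\ge1}$, over all $\xi\in\Sigma$. An element $\xi\in\Sigma$ is periodic if $\sigma^p\xi=\xi$ for some $p>0$. $P_\phi$ is the set of all points $\sum_{i=1}^k t_i\rho_\phi(\xi_i)$ with $k\ge1$, $\xi_1,\dots,\xi_k$ periodic, $t_i\ge0$, $\sum t_i=1$. *)

theory Defs
  imports "HOL-Analysis.Analysis"
begin

definition strictly_convex :: "'a::euclidean_space set \<Rightarrow> bool" where
  "strictly_convex A \<longleftrightarrow> convex A \<and>
     (\<forall>x\<in>A. \<forall>y\<in>A. x \<noteq> y \<longrightarrow> open_segment x y \<subseteq> interior A)"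

definition C2_boundary :: "'a::euclidean_space set \<Rightarrow> bool" where
  "C2_boundary A \<longleftrightarrow>
     (\<forall>p\<in>frontier A. \<exists>U f g H. open U \<and> p \<in> U \<and>
        (\<forall>x\<in>U. (f has_derivative (\<lambda>h. g x \<bullet> h)) (at x)) \<and>
        (\<forall>x\<in>U. (g has_derivative H x) (at x)) \<and>
        (\<forall>h. continuous_on U (\<lambda>x. H x h)) \<and>
        (\<forall>x\<in>U. g x \<noteq> 0) \<and>
        A \<inter> U = {x\<in>U. f x \<le> 0})"

definition open_billiard :: "(nat \<Rightarrow> 'a::euclidean_space set) \<Rightarrow> nat \<Rightarrow> bool" where
  "open_billiard K s \<longleftrightarrow>
     (\<forall>i\<in>{1..s}. compact (K i) \<and> interior (K i) \<noteq> {} \<and>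
                  strictly_convex (K i) \<and> C2_boundary (K i)) \<and>
     (\<forall>i\<in>{1..s}. \<forall>j\<in>{1..s}. i \<noteq> j \<longrightarrow> K i \<inter> K j = {}) \<and>
     (\<forall>i\<in>{1..s}. \<forall>j\<in>{1..s}. \<forall>k\<in>{1..s}. i \<noteq> j \<and> j \<noteq> k \<and> i \<noteq> k \<longrightarrow>
          convex hull (K i \<union> K j) \<inter> K k = {})"

definition obstacle :: "(nat \<Rightarrow> 'a::euclidean_space set) \<Rightarrow> nat \<Rightarrow> 'a set" where
  "obstacle K s = (\<Union>i\<in>{1..s}. K i)"

definition symbol_space :: "nat \<Rightarrow> (int \<Rightarrow> nat) set" where
  "symbol_space s = {\<xi>. (\<forall>i. \<xi> i \<in> {1..s}) \<and> (\<forall>i. \<xi> i \<noteq> \<xi> (i + 1))}"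

definition shift :: "(int \<Rightarrow> nat) \<Rightarrow> (int \<Rightarrow> nat)" where
  "shift \<xi> = (\<lambda>i. \<xi> (i + 1))"

definition periodic_seq :: "(int \<Rightarrow> nat) \<Rightarrow> bool" where
  "periodic_seq \<xi> \<longleftrightarrow> (\<exists>p>0. (shift ^^ p) \<xi> = \<xi>)"

definition outer_normal :: "'a::euclidean_space set \<Rightarrow> 'a \<Rightarrow> 'a \<Rightarrow> bool" where
  "outer_normal A p n \<longleftrightarrow> norm n = 1 \<and> (\<forall>x\<in>A. (x - p) \<bullet> n \<le> 0)"

definition billiard_orbit ::
  "(nat \<Rightarrow> 'a::euclidean_space set) \<Rightarrow> nat \<Rightarrow> (int \<Rightarrow> nat) \<Rightarrow> (int \<Rightarrow> 'a) \<Rightarrow> bool" where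
  "billiard_orbit K s \<xi> q \<longleftrightarrow>
     (\<forall>i. q i \<in> frontier (K (\<xi> i)) \<and> q i \<noteq> q (i + 1) \<and>
          open_segment (q i) (q (i + 1)) \<inter> obstacle K s = {} \<and>
          (\<exists>n. outer_normal (K (\<xi> i)) (q i) n \<and>
               sgn (q (i + 1) - q i) =
                 sgn (q i - q (i - 1)) - (2 * (sgn (q i - q (i - 1)) \<bullet> n)) *\<^sub>R n))"

definition phi :: "(nat \<Rightarrow> 'a::euclidean_space set) \<Rightarrow> nat \<Rightarrow> (int \<Rightarrow> nat) \<Rightarrow> 'a" where
  "phi K s \<xi> = fst (THE yv. \<exists>q. billiard_orbit K s \<xi> q \<and>
                              yv = (q 0, sgn (q 1 - q 0)))"

definition birkhoff_avg :: "((int \<Rightarrow> nat) \<Rightarrow> 'a::real_normed_vector) \<Rightarrow> (int \<Rightarrow> nat) \<Rightarrow> nat \<Rightarrow> 'a" where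
  "birkhoff_avg f \<xi> n = (1 / real n) *\<^sub>R (\<Sum>i<n. f ((shift ^^ i) \<xi>))"

definition rotation_vector :: "((int \<Rightarrow> nat) \<Rightarrow> 'a::real_normed_vector) \<Rightarrow> (int \<Rightarrow> nat) \<Rightarrow> 'a" where
  "rotation_vector f \<xi> = lim (\<lambda>n. birkhoff_avg f \<xi> (Suc n))"

definition general_rotation_set ::
  "((int \<Rightarrow> nat) \<Rightarrow> 'a::real_normed_vector) \<Rightarrow> (int \<Rightarrow> nat) set \<Rightarrow> 'a set" where
  "general_rotation_set f S = {z. \<exists>\<xi>\<in>S. \<exists>r. strict_mono r \<and>
       (\<lambda>k. birkhoff_avg f \<xi> (Suc (r k))) \<longlonglongrightarrow> z}"

definition periodic_rotation_set ::
  "((int \<Rightarrow> nat) \<Rightarrow> 'a::real_normed_vector) \<Rightarrow> (int \<Rightarrow> nat) set \<Rightarrow> 'a set" where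
  "periodic_rotation_set f S =
     convex hull {rotation_vector f \<xi> | \<xi>. \<xi> \<in> S \<and> periodic_seq \<xi>}"

end

theory Submission
  imports Defs
begin

text \<open>An orbit with a given itinerary is a critical point of the length functional, which is convex, so the
  orbit exists by minimising finite pieces of it and compactness, and strict convexity of the
  obstacles makes it unique. Compactness then turns uniqueness into uniform dependence of
  \<open>\<phi>(\<xi>)\<close> on finitely many symbols around 0. For such an observable, averages over words
  depend on the word only up to an error that is negligible against its length. Since any two words can be joined by one connecting
  letter, words can be repeated, mixed in any proportion and concatenated with rapidly growing
  lengths: \<open>G\<close> is the closed convex set of values approximable by averages over all
  long words, and periodic repetition of long words makes the periodic vectors dense in it.\<close>

section \<open>Rotation sets over the symbol space\<close>

text \<open>The length of a bi-infinite path diverges, so orbits cannot be compared by total length.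
  Two conditions local to a single bounce take its place. Minimality of the broken path through
  three consecutive points is a family of inequalities between distances, hence closed in the
  product topology, and carries both compactness arguments. Criticality is its first-order
  variational inequality; being linear in the test point, it lets two orbits be tested against each
  other, and it encodes reflection without naming a normal. Nor is length strictly convex: the norm
  is linear along rays, so comparing two orbits first yields only equal directions, and the
  obstacles must turn this into equal points. On the symbolic side,
  \<open>general_rotation_set\<close> uses subsequences of averages of one sequence, and two such
  subsequences may live on incompatible lengths. \<open>approx_set\<close> asks for every large
  length instead and lets the sequence depend on it.\<close>

definition birkhoff_sum :: "((int \<Rightarrow> nat) \<Rightarrow> 'a::real_normed_vector) \<Rightarrow> (int \<Rightarrow> nat) \<Rightarrow> nat \<Rightarrow> 'a" where
  "birkhoff_sum f \<xi> n = (\<Sum>i<n. f ((shift ^^ i) \<xi>))"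

lemma birkhoff_avg_eq: "birkhoff_avg f \<xi> n = (1 / real n) *\<^sub>R birkhoff_sum f \<xi> n"
  by (simp add: birkhoff_avg_def birkhoff_sum_def)

lemma funpow_shift: "(shift ^^ n) \<xi> = (\<lambda>i. \<xi> (i + int n))"
  by (induction n) (auto simp: shift_def algebra_simps)

lemma shift_in_symbol_space: "\<xi> \<in> symbol_space s \<Longrightarrow> (shift ^^ n) \<xi> \<in> symbol_space s"
  by (auto simp: symbol_space_def funpow_shift) (metis add.assoc add.commute)

lemma symbol_spaceD:
  assumes "\<xi> \<in> symbol_space s"
  shows "\<xi> i \<in> {1..s}" "\<xi> i \<noteq> \<xi> (i + 1)"
  using assms unfolding symbol_space_def by blast+

lemma birkhoff_sum_add:
  "birkhoff_sum f \<xi> (n + m) = birkhoff_sum f \<xi> n + birkhoff_sum f ((shift ^^ n) \<xi>) m"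
proof (induction m)
  case (Suc m)
  have "(shift ^^ (n + m)) \<xi> = (shift ^^ m) ((shift ^^ n) \<xi>)"
    by (metis add.commute comp_apply funpow_add)
  then show ?case using Suc by (simp add: birkhoff_sum_def)
qed (simp add: birkhoff_sum_def)

section \<open>Joining and periodizing symbol sequences\<close>

lemma ex_connecting_letter:
  assumes "s \<ge> 3"
  obtains c :: nat where "c \<in> {1..s}" "c \<noteq> a" "c \<noteq> b"
proof -
  have "card ({1..3::nat} - {a, b}) > 0"
    using diff_card_le_card_Diff[of "{a,b}" "{1..3::nat}"] card_insert_le_m1[of 2 "{b}" a] by fastforce
  then have "{1..3::nat} - {a, b} \<noteq> {}" by (metis card.empty less_irrefl)
  then show ?thesis using that assms by fastforce
qed

text \<open>Everything left of position \<open>n\<close> is taken from \<open>\<xi>\<close>,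
  negative positions included, so repeated gluing never disturbs the left half-line. Of
  \<open>\<eta>\<close> only the nonnegative half survives.\<close>

definition glue :: "(int \<Rightarrow> nat) \<Rightarrow> nat \<Rightarrow> nat \<Rightarrow> (int \<Rightarrow> nat) \<Rightarrow> (int \<Rightarrow> nat)" where
  "glue \<xi> n c \<eta> = (\<lambda>i. if i < int n then \<xi> i else if i = int n then c else \<eta> (i - int n - 1))"

lemma glue_in_symbol_space:
  assumes "\<xi> \<in> symbol_space s" "\<eta> \<in> symbol_space s" "c \<in> {1..s}"
    and "c \<noteq> \<xi> (int n - 1)" "c \<noteq> \<eta> 0"
  shows "glue \<xi> n c \<eta> \<in> symbol_space s"
proof -
  have "glue \<xi> n c \<eta> i \<in> {1..s}" for i
    using symbol_spaceD(1)[OF assms(1)] symbol_spaceD(1)[OF assms(2)] assms(3)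
    by (auto simp: glue_def)
  moreover have "glue \<xi> n c \<eta> i \<noteq> glue \<xi> n c \<eta> (i + 1)" for i
  proof -
    consider "i + 1 < int n" | "i + 1 = int n" | "i = int n" | "i > int n" by linarith
    then show ?thesis
    proof cases
      case 1
      then show ?thesis using symbol_spaceD(2)[OF assms(1), of i] by (simp add: glue_def)
    next
      case 2
      then have "i = int n - 1" by simp
      then show ?thesis using assms(4) by (simp add: glue_def)
    next
      case 3
      then show ?thesis using assms(5) by (simp add: glue_def)
    next
      case 4
      then show ?thesis using symbol_spaceD(2)[OF assms(2), of "i - int n - 1"] by (simp add: glue_def)
    qed
  qed
  ultimately show ?thesis by (auto simp: symbol_space_def)
qed

lemma ex_glue:
  assumes "s \<ge> 3" "\<xi> \<in> symbol_space s" "\<eta> \<in> symbol_space s"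
  obtains \<zeta> where "\<zeta> \<in> symbol_space s" "\<And>i. i < int n \<Longrightarrow> \<zeta> i = \<xi> i"
    "\<And>i. i \<ge> 0 \<Longrightarrow> (shift ^^ Suc n) \<zeta> i = \<eta> i"
proof -
  obtain c where c: "c \<in> {1..s}" "c \<noteq> \<xi> (int n - 1)" "c \<noteq> \<eta> 0"
    using ex_connecting_letter[OF assms(1)] by blast
  show ?thesis
    by (rule that[OF glue_in_symbol_space[OF assms(2,3) c]])
      (auto simp: glue_def funpow_shift simp del: funpow.simps)
qed

text \<open>A word need not be allowed to follow itself. One connecting letter closes it into a
  loop, which is why the period is \<open>Suc n\<close> and not \<open>n\<close>.\<close>

lemma ex_periodization:
  assumes "s \<ge> 3" "\<xi> \<in> symbol_space s" "n > 0"
  obtains \<eta> where "\<eta> \<in> symbol_space s" "(shift ^^ Suc n) \<eta> = \<eta>"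
    "\<And>i. 0 \<le> i \<Longrightarrow> i < int n \<Longrightarrow> \<eta> i = \<xi> i"
proof -
  obtain c where c: "c \<in> {1..s}" "c \<noteq> \<xi> (int n - 1)" "c \<noteq> \<xi> 0"
    using ex_connecting_letter[OF assms(1)] by blast
  define P where "P = int n + 1"
  define \<eta> where "\<eta> i = (if i mod P = int n then c else \<xi> (i mod P))" for i
  have P: "P > 0" by (simp add: P_def)
  have "\<eta> i \<in> {1..s}" for i
    using symbol_spaceD(1)[OF assms(2)] c by (auto simp: \<eta>_def)
  moreover have "\<eta> i \<noteq> \<eta> (i + 1)" for i
  proof -
    define r where "r = i mod P"
    have r: "0 \<le> r" "r < P" using P by (auto simp: r_def)
    have r1: "(i + 1) mod P = (r + 1) mod P" by (simp add: r_def mod_add_left_eq)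
    consider "r = int n" | "r = int n - 1" | "r + 1 < int n" using r P_def by linarith
    then show ?thesis
    proof cases
      case 1
      then have "(i + 1) mod P = 0" using r1 by (simp add: P_def)
      then show ?thesis using c 1 assms(3) by (simp add: \<eta>_def r_def[symmetric])
    next
      case 2
      then have "(i + 1) mod P = int n" using r1 by (simp add: P_def)
      then show ?thesis using c 2 by (simp add: \<eta>_def r_def[symmetric])
    next
      case 3
      then have "(i + 1) mod P = r + 1" using r1 r by (simp add: P_def)
      then show ?thesis using 3 symbol_spaceD(2)[OF assms(2), of r]
        by (simp add: \<eta>_def r_def[symmetric])
    qed
  qed
  ultimately have "\<eta> \<in> symbol_space s" by (auto simp: symbol_space_def)
  moreover have "(shift ^^ Suc n) \<eta> = \<eta>"
  proof -
    have "(i + int (Suc n)) mod P = i mod P" for i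
      by (simp add: P_def add.commute[of 1])
    then show ?thesis unfolding funpow_shift
      by (intro ext) (simp add: \<eta>_def del: of_nat_Suc)
  qed
  moreover have "\<eta> i = \<xi> i" if "0 \<le> i" "i < int n" for i
    using that by (simp add: \<eta>_def P_def)
  ultimately show ?thesis using that by blast
qed

text \<open>The deviation \<open>d n\<close> of the sum from \<open>n\<close> times the average over
  one period is itself \<open>p\<close>-periodic, hence bounded, and division by the length removes
  it.\<close>

lemma birkhoff_avg_periodic:
  assumes "p > 0" "(shift ^^ p) \<xi> = \<xi>"
  shows "(\<lambda>n. birkhoff_avg f \<xi> (Suc n)) \<longlonglongrightarrow> birkhoff_avg f \<xi> p"
proof -
  define v where "v = birkhoff_avg f \<xi> p"
  define d where "d n = birkhoff_sum f \<xi> n - real n *\<^sub>R v" for n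
  define C where "C = (\<Sum>j<p. norm (d j))"
  have "birkhoff_sum f \<xi> (p + n) = real p *\<^sub>R v + birkhoff_sum f \<xi> n" for n
    using assms by (simp add: birkhoff_sum_add v_def birkhoff_avg_eq)
  then have "d (p + n) = d n" for n
    by (simp add: d_def algebra_simps)
  have bound: "norm (d n) \<le> C" for n
  proof (induction n rule: less_induct)
    case (less n)
    show ?case
    proof (cases "n < p")
      case True
      then show ?thesis unfolding C_def by (intro member_le_sum) auto
    next
      case False
      then have "d n = d (n - p)" using \<open>\<And>n. d (p + n) = d n\<close>[of "n - p"] by simp
      then show ?thesis using less[of "n - p"] False assms by simp
    qed
  qed
  have "norm (birkhoff_avg f \<xi> (Suc n) - v) \<le> C * inverse (real (Suc n))" for n
  proof -
    have "birkhoff_avg f \<xi> (Suc n) - v = (1 / real (Suc n)) *\<^sub>R d (Suc n)"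
      by (simp add: birkhoff_avg_eq d_def algebra_simps del: of_nat_Suc)
    then have "norm (birkhoff_avg f \<xi> (Suc n) - v) = norm (d (Suc n)) * inverse (real (Suc n))"
      by (simp add: divide_simps del: of_nat_Suc)
    then show ?thesis using bound[of "Suc n"] by (simp add: mult_right_mono)
  qed
  moreover have "(\<lambda>n. C * inverse (real (Suc n))) \<longlonglongrightarrow> 0"
    using tendsto_mult_right_zero[OF LIMSEQ_inverse_real_of_nat] by blast
  ultimately have "(\<lambda>n. birkhoff_avg f \<xi> (Suc n) - v) \<longlonglongrightarrow> 0"
    by (rule_tac Lim_null_comparison) (auto intro: always_eventually)
  then show ?thesis unfolding v_def by (simp add: LIM_zero_iff)
qed

lemma rotation_vector_periodic:
  assumes "p > 0" "(shift ^^ p) \<xi> = \<xi>"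
  shows "rotation_vector f \<xi> = birkhoff_avg f \<xi> p"
  unfolding rotation_vector_def by (rule limI[OF birkhoff_avg_periodic[OF assms]])

text \<open>The sequence may change with the length \<open>p\<close>, but every large length must be
  served. This is what allows words of prescribed lengths to be combined.\<close>

definition approx_set ::
  "((int \<Rightarrow> nat) \<Rightarrow> 'a::real_normed_vector) \<Rightarrow> (int \<Rightarrow> nat) set \<Rightarrow> 'a set" where
  "approx_set f S = {z. \<forall>e>0. \<exists>m. \<forall>p\<ge>m. \<exists>\<eta>\<in>S. norm (birkhoff_avg f \<eta> p - z) < e}"

lemma closed_approx_set: "closed (approx_set f S)"
proof -
  have "z \<in> approx_set f S" if z: "z \<in> closure (approx_set f S)" for z
    unfolding approx_set_def
  proof (intro CollectI allI impI)
    fix e :: real assume "e > 0"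
    then obtain y where y: "y \<in> approx_set f S" "norm (y - z) < e / 2"
      using z unfolding closure_approachable dist_norm by (meson half_gt_zero)
    have "e / 2 > 0" using \<open>e > 0\<close> by simp
    then obtain m where m: "\<forall>p\<ge>m. \<exists>\<eta>\<in>S. norm (birkhoff_avg f \<eta> p - y) < e / 2"
      using y(1) unfolding approx_set_def by blast
    have "norm (a - z) < e" if "norm (a - y) < e / 2" for a
      using norm_triangle_ineq[of "a - y" "y - z"] that y(2) by simp
    then show "\<exists>m. \<forall>p\<ge>m. \<exists>\<eta>\<in>S. norm (birkhoff_avg f \<eta> p - z) < e"
      using m by blast
  qed
  then show ?thesis by (metis closure_subset_eq subsetI)
qed

lemma periodic_in_approx_set:
  assumes "\<xi> \<in> S" "periodic_seq \<xi>"
  shows "rotation_vector f \<xi> \<in> approx_set f S"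
proof -
  obtain p where p: "p > 0" "(shift ^^ p) \<xi> = \<xi>"
    using assms(2) unfolding periodic_seq_def by blast
  show ?thesis unfolding approx_set_def
  proof (intro CollectI allI impI)
    fix e :: real assume "e > 0"
    then obtain m where m: "\<forall>n\<ge>m. norm (birkhoff_avg f \<xi> (Suc n) - rotation_vector f \<xi>) < e"
      using LIMSEQ_D[OF birkhoff_avg_periodic[OF p, of f]] unfolding rotation_vector_periodic[OF p]
      by blast
    have "norm (birkhoff_avg f \<xi> q - rotation_vector f \<xi>) < e" if "q \<ge> Suc m" for q
      using m[rule_format, of "q - 1"] that by simp
    then show "\<exists>m. \<forall>p\<ge>m. \<exists>\<eta>\<in>S. norm (birkhoff_avg f \<eta> p - rotation_vector f \<xi>) < e"
      using assms(1) by blast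
  qed
qed

text \<open>\<open>window\<close> is uniform continuity for the product topology, spelled out in
  symbols. With boundedness it is all that the rotation theory uses of the billiard.\<close>

locale window_continuous_observable =
  fixes f :: "(int \<Rightarrow> nat) \<Rightarrow> 'a::real_normed_vector" and s :: nat and B :: real
  assumes s: "s \<ge> 3"
    and B: "B \<ge> 0"
    and bounded: "\<And>\<xi>. \<xi> \<in> symbol_space s \<Longrightarrow> norm (f \<xi>) \<le> B"
    and window: "\<And>e. e > 0 \<Longrightarrow> \<exists>M::nat. \<forall>\<xi>\<in>symbol_space s. \<forall>\<eta>\<in>symbol_space s.
        (\<forall>i. \<bar>i\<bar> \<le> int M \<longrightarrow> \<xi> i = \<eta> i) \<longrightarrow> norm (f \<xi> - f \<eta>) < e"
begin

abbreviation "\<Sigma> \<equiv> symbol_space s"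

section \<open>Averages over words and their periodic approximation\<close>

lemma norm_birkhoff_sum_le: "\<xi> \<in> \<Sigma> \<Longrightarrow> norm (birkhoff_sum f \<xi> n) \<le> real n * B"
  unfolding birkhoff_sum_def
  by (rule order_trans[OF sum_norm_bound[of _ _ B]]) (auto intro: bounded shift_in_symbol_space)

text \<open>At a time with distance at least \<open>M\<close> from both ends of the word the two
  sequences agree on the whole window and the terms differ by less than \<open>e\<close>. At most
  \<open>2 * M\<close> times are left, each costing at most \<open>2 * B\<close>; hence a constant
  independent of \<open>n\<close>.\<close>

lemma birkhoff_sum_close:
  assumes "e > 0"
  obtains C where "\<And>n \<xi> \<eta>. \<lbrakk>\<xi> \<in> \<Sigma>; \<eta> \<in> \<Sigma>; \<And>i. 0 \<le> i \<Longrightarrow> i < int n \<Longrightarrow> \<xi> i = \<eta> i\<rbrakk>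
    \<Longrightarrow> norm (birkhoff_sum f \<xi> n - birkhoff_sum f \<eta> n) \<le> e * real n + C"
proof -
  obtain M :: nat where M: "\<And>\<xi> \<eta>. \<lbrakk>\<xi> \<in> \<Sigma>; \<eta> \<in> \<Sigma>; \<And>i. \<bar>i\<bar> \<le> int M \<Longrightarrow> \<xi> i = \<eta> i\<rbrakk>
     \<Longrightarrow> norm (f \<xi> - f \<eta>) < e"
    using window[OF assms] by metis
  show ?thesis
  proof (rule that)
    fix n \<xi> \<eta> assume \<xi>: "\<xi> \<in> \<Sigma>" and \<eta>: "\<eta> \<in> \<Sigma>"
      and eq: "\<And>i. 0 \<le> i \<Longrightarrow> i < int n \<Longrightarrow> \<xi> i = \<eta> i"
    have "norm (f ((shift ^^ i) \<xi>) - f ((shift ^^ i) \<eta>))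
        \<le> e + 2 * B * of_bool (i < M) + 2 * B * of_bool (n \<le> i + M)" if "i < n" for i
    proof (cases "M \<le> i \<and> i + M < n")
      case True
      then have "norm (f ((shift ^^ i) \<xi>) - f ((shift ^^ i) \<eta>)) < e"
        by (intro M shift_in_symbol_space \<xi> \<eta>) (auto simp: funpow_shift intro!: eq)
      then show ?thesis using B True by simp
    next
      case False
      have "norm (f ((shift ^^ i) \<xi>) - f ((shift ^^ i) \<eta>)) \<le> 2 * B"
        using norm_triangle_ineq4[of "f ((shift ^^ i) \<xi>)" "f ((shift ^^ i) \<eta>)"]
          bounded[OF shift_in_symbol_space[OF \<xi>, of i]] bounded[OF shift_in_symbol_space[OF \<eta>, of i]]
        by linarith
      then show ?thesis using False assms B by (auto simp: of_bool_def)
    qed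
    then have "norm (birkhoff_sum f \<xi> n - birkhoff_sum f \<eta> n)
      \<le> (\<Sum>i<n. e + 2 * B * of_bool (i < M) + 2 * B * of_bool (n \<le> i + M))"
      unfolding birkhoff_sum_def sum_subtractf[symmetric] by (intro sum_norm_le) auto
    also have "\<dots> = e * n + 2 * B * (\<Sum>i<n. of_bool (i < M)) + 2 * B * (\<Sum>i<n. of_bool (n \<le> i + M))"
      by (simp add: sum.distrib sum_distrib_left)
    also have "(\<Sum>i<n. of_bool (i < M)) = real (card {i. i < n \<and> i < M})"
      by (simp add: of_bool_def sum.If_cases Collect_conj_eq lessThan_def)
    also have "(\<Sum>i<n. of_bool (n \<le> i + M)) = real (card {i. i < n \<and> n \<le> i + M})"
      by (simp add: of_bool_def sum.If_cases Collect_conj_eq lessThan_def)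
    also have "card {i. i < n \<and> i < M} \<le> M"
      using card_mono[of "{..<M}" "{i. i < n \<and> i < M}"] by auto
    also have "card {i. i < n \<and> n \<le> i + M} \<le> M"
    proof -
      have "{i. i < n \<and> n \<le> i + M} \<subseteq> {n-M..<n}" by auto
      then have "card {i. i < n \<and> n \<le> i + M} \<le> card {n-M..<n}"
        by (intro card_mono) auto
      then show ?thesis by simp
    qed
    finally show "norm (birkhoff_sum f \<xi> n - birkhoff_sum f \<eta> n) \<le> e * real n + 4 * B * M"
      using B by (simp add: mult_left_mono)
  qed
qed

lemma birkhoff_avg_close:
  assumes "e > 0"
  obtains m where "m > 0"
    "\<And>n \<xi> \<eta>. \<lbrakk>m \<le> n; \<xi> \<in> \<Sigma>; \<eta> \<in> \<Sigma>; \<And>i. 0 \<le> i \<Longrightarrow> i < int n \<Longrightarrow> \<xi> i = \<eta> i\<rbrakk>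
    \<Longrightarrow> norm (birkhoff_avg f \<xi> n - birkhoff_avg f \<eta> n) < e"
proof -
  obtain C where C: "\<And>n \<xi> \<eta>. \<lbrakk>\<xi> \<in> \<Sigma>; \<eta> \<in> \<Sigma>; \<And>i. 0 \<le> i \<Longrightarrow> i < int n \<Longrightarrow> \<xi> i = \<eta> i\<rbrakk>
    \<Longrightarrow> norm (birkhoff_sum f \<xi> n - birkhoff_sum f \<eta> n) \<le> (e / 2) * real n + C"
    using birkhoff_sum_close[of "e / 2"] assms by auto
  obtain m :: nat where m: "real m > 2 * \<bar>C\<bar> / e" using reals_Archimedean2 by blast
  show ?thesis
  proof (rule that)
    show "Suc m > 0" by simp
    fix n \<xi> \<eta> assume n: "Suc m \<le> n" and "\<xi> \<in> \<Sigma>" "\<eta> \<in> \<Sigma>" "\<And>i. 0 \<le> i \<Longrightarrow> i < int n \<Longrightarrow> \<xi> i = \<eta> i"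
    then have 1: "norm (birkhoff_sum f \<xi> n - birkhoff_sum f \<eta> n) \<le> (e / 2) * real n + C"
      using C by blast
    have "2 * \<bar>C\<bar> / e < real n" using m n by linarith
    then have "C < (e / 2) * real n" using assms by (simp add: field_simps)
    then have "norm (birkhoff_sum f \<xi> n - birkhoff_sum f \<eta> n) < e * real n" using 1 by (simp add: field_simps)
    moreover have "norm (birkhoff_avg f \<xi> n - birkhoff_avg f \<eta> n)
      = norm (birkhoff_sum f \<xi> n - birkhoff_sum f \<eta> n) / real n"
      unfolding birkhoff_avg_eq scaleR_diff_right[symmetric] by simp
    ultimately show "norm (birkhoff_avg f \<xi> n - birkhoff_avg f \<eta> n) < e"
      using n by (simp add: divide_less_eq)
  qed
qed

text \<open>Two errors arise: leaving \<open>\<xi>\<close> for a sequence with the same first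
  \<open>n\<close> letters, and averaging over the period \<open>Suc n\<close> instead of
  \<open>n\<close>. The second is at most \<open>2 * B / real (Suc n)\<close>, which explains the
  choice of \<open>k\<close>.\<close>

lemma approx_by_periodic:
  assumes "e > 0"
  obtains m where "m > 0" "\<And>n \<xi>. \<lbrakk>m \<le> n; \<xi> \<in> \<Sigma>\<rbrakk> \<Longrightarrow>
    \<exists>\<eta>\<in>\<Sigma>. periodic_seq \<eta> \<and> norm (birkhoff_avg f \<xi> n - rotation_vector f \<eta>) < e"
proof -
  obtain m where m: "m > 0"
    "\<And>n \<xi> \<eta>. \<lbrakk>m \<le> n; \<xi> \<in> \<Sigma>; \<eta> \<in> \<Sigma>; \<And>i. 0 \<le> i \<Longrightarrow> i < int n \<Longrightarrow> \<xi> i = \<eta> i\<rbrakk>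
    \<Longrightarrow> norm (birkhoff_avg f \<xi> n - birkhoff_avg f \<eta> n) < e / 2"
    using birkhoff_avg_close[of "e / 2"] assms by auto
  obtain k :: nat where k: "real k > 4 * B / e" using reals_Archimedean2 by blast
  show ?thesis
  proof (rule that)
    show "m + k > 0" using m by simp
    fix n \<xi> assume n: "m + k \<le> n" and \<xi>: "\<xi> \<in> \<Sigma>"
    then have "n > 0" using m by simp
    then obtain \<eta> where \<eta>: "\<eta> \<in> \<Sigma>" "(shift ^^ Suc n) \<eta> = \<eta>"
      and eq: "\<And>i. 0 \<le> i \<Longrightarrow> i < int n \<Longrightarrow> \<eta> i = \<xi> i"
      using ex_periodization[OF s \<xi>] by blast
    have rot: "rotation_vector f \<eta> = birkhoff_avg f \<eta> (Suc n)"
      using rotation_vector_periodic[OF _ \<eta>(2)] by blast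
    have "birkhoff_sum f \<eta> (Suc n) = birkhoff_sum f \<eta> n + f ((shift ^^ n) \<eta>)"
      by (simp add: birkhoff_sum_def)
    then have "birkhoff_avg f \<eta> n - birkhoff_avg f \<eta> (Suc n)
      = (1 / real (Suc n)) *\<^sub>R (birkhoff_avg f \<eta> n - f ((shift ^^ n) \<eta>))"
    proof -
      have "1 / real n - 1 / real (Suc n) = (1 / real (Suc n)) * (1 / real n)"
        using \<open>n > 0\<close> by (simp add: field_simps)
      then have "(1 / real n) *\<^sub>R S - (1 / real (Suc n)) *\<^sub>R S
          = (1 / real (Suc n)) *\<^sub>R (1 / real n) *\<^sub>R S" for S :: 'a
        by (metis scaleR_left_diff_distrib scaleR_scaleR)
      then show ?thesis
        unfolding birkhoff_avg_eq \<open>birkhoff_sum f \<eta> (Suc n) = _\<close>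
        by (simp only: scaleR_add_right scaleR_diff_right diff_diff_eq[symmetric])
    qed
    moreover have "norm (birkhoff_avg f \<eta> n - f ((shift ^^ n) \<eta>)) \<le> 2 * B"
    proof -
      have "norm (birkhoff_avg f \<eta> n) \<le> B"
        using norm_birkhoff_sum_le[OF \<eta>(1), of n] \<open>n > 0\<close> by (simp add: birkhoff_avg_eq field_simps)
      then show ?thesis
        using norm_triangle_ineq4[of "birkhoff_avg f \<eta> n" "f ((shift ^^ n) \<eta>)"]
          bounded[OF shift_in_symbol_space[OF \<eta>(1), of n]] by linarith
    qed
    ultimately have "norm (birkhoff_avg f \<eta> n - birkhoff_avg f \<eta> (Suc n)) \<le> 2 * B / real (Suc n)"
      by (simp add: divide_right_mono del: of_nat_Suc)
    also have "\<dots> < e / 2"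
    proof -
      have "4 * B / e < real (Suc n)" using k n by linarith
      then show ?thesis using assms by (simp add: field_simps del: of_nat_Suc)
    qed
    finally have 1: "norm (birkhoff_avg f \<eta> n - birkhoff_avg f \<eta> (Suc n)) < e / 2" .
    have 2: "norm (birkhoff_avg f \<xi> n - birkhoff_avg f \<eta> n) < e / 2"
      using n \<xi> \<eta>(1) eq by (intro m(2)) auto
    have "norm (birkhoff_avg f \<xi> n - rotation_vector f \<eta>) < e"
      using 1 2 norm_triangle_ineq[of "birkhoff_avg f \<xi> n - birkhoff_avg f \<eta> n"
         "birkhoff_avg f \<eta> n - birkhoff_avg f \<eta> (Suc n)"] unfolding rot by simp
    then show "\<exists>\<eta>\<in>\<Sigma>. periodic_seq \<eta> \<and> norm (birkhoff_avg f \<xi> n - rotation_vector f \<eta>) < e"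
      using \<eta> unfolding periodic_seq_def by blast
  qed
qed

text \<open>A single periodic sequence already comes close to a given limit, so density is obtained
  before any convex combination is formed.\<close>

lemma general_rotation_set_subset_closure:
  "general_rotation_set f \<Sigma> \<subseteq> closure {rotation_vector f \<eta> | \<eta>. \<eta> \<in> \<Sigma> \<and> periodic_seq \<eta>}"
proof
  fix z assume "z \<in> general_rotation_set f \<Sigma>"
  then obtain \<xi> r where \<xi>: "\<xi> \<in> \<Sigma>" and r: "strict_mono r"
    and lim: "(\<lambda>k. birkhoff_avg f \<xi> (Suc (r k))) \<longlonglongrightarrow> z"
    unfolding general_rotation_set_def by blast
  show "z \<in> closure {rotation_vector f \<eta> | \<eta>. \<eta> \<in> \<Sigma> \<and> periodic_seq \<eta>}"
    unfolding closure_approachable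
  proof (intro allI impI)
    fix e :: real assume "e > 0"
    then obtain k0 where k0: "\<And>k. k \<ge> k0 \<Longrightarrow> norm (birkhoff_avg f \<xi> (Suc (r k)) - z) < e / 2"
      using LIMSEQ_D[OF lim, of "e / 2"] by auto
    obtain m where m: "\<And>n \<xi>. \<lbrakk>m \<le> n; \<xi> \<in> \<Sigma>\<rbrakk> \<Longrightarrow>
        \<exists>\<eta>\<in>\<Sigma>. periodic_seq \<eta> \<and> norm (birkhoff_avg f \<xi> n - rotation_vector f \<eta>) < e / 2"
      using approx_by_periodic[of "e / 2"] \<open>e > 0\<close> by (metis half_gt_zero)
    define k where "k = k0 + m"
    have "m \<le> Suc (r k)" using seq_suble[OF r, of k] by (simp add: k_def)
    then obtain \<eta> where \<eta>: "\<eta> \<in> \<Sigma>" "periodic_seq \<eta>"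
       "norm (birkhoff_avg f \<xi> (Suc (r k)) - rotation_vector f \<eta>) < e / 2"
      using m \<xi> by blast
    have "dist (rotation_vector f \<eta>) z < e"
      using k0[of k] \<eta>(3) norm_triangle_ineq4[of "birkhoff_avg f \<xi> (Suc (r k)) - z"
         "birkhoff_avg f \<xi> (Suc (r k)) - rotation_vector f \<eta>"]
      by (simp add: k_def dist_norm)
    then show "\<exists>y\<in>{rotation_vector f \<eta> | \<eta>. \<eta> \<in> \<Sigma> \<and> periodic_seq \<eta>}. dist y z < e"
      using \<eta> by blast
  qed
qed

section \<open>Mixing and concatenating words\<close>

lemma norm_birkhoff_sum_approx:
  assumes "norm (birkhoff_avg f \<xi> n - z) < e" "n > 0"
  shows "norm (birkhoff_sum f \<xi> n - real n *\<^sub>R z) \<le> e * real n"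
proof -
  have "birkhoff_sum f \<xi> n - real n *\<^sub>R z = real n *\<^sub>R (birkhoff_avg f \<xi> n - z)"
    using assms(2) by (simp add: birkhoff_avg_eq scaleR_diff_right)
  then show ?thesis using assms by (simp add: mult.commute mult_left_mono)
qed

lemma norm_birkhoff_avg_approx:
  assumes "norm (birkhoff_sum f \<xi> n - real n *\<^sub>R z) < e * real n" "n > 0"
  shows "norm (birkhoff_avg f \<xi> n - z) < e"
proof -
  have "birkhoff_sum f \<xi> n - real n *\<^sub>R z = real n *\<^sub>R (birkhoff_avg f \<xi> n - z)"
    using assms(2) by (simp add: birkhoff_avg_eq scaleR_diff_right)
  then show ?thesis using assms by (simp add: mult.commute)
qed

lemma convex_approx_set: "convex (approx_set f \<Sigma>)"
proof -
  have "u *\<^sub>R x + v *\<^sub>R y \<in> approx_set f \<Sigma>"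
    if x: "x \<in> approx_set f \<Sigma>" and y: "y \<in> approx_set f \<Sigma>"
      and uv: "u > 0" "v > 0" "u + v = 1" for x y u v
    unfolding approx_set_def
  proof (intro CollectI allI impI)
    fix e :: real assume e: "e > 0"
    then have e4: "e / 4 > 0" by simp
    obtain m1 where m1: "\<And>p. p \<ge> m1 \<Longrightarrow> \<exists>\<eta>\<in>\<Sigma>. norm (birkhoff_avg f \<eta> p - x) < e / 4"
      using x e4 unfolding approx_set_def by blast
    obtain m2 where m2: "\<And>p. p \<ge> m2 \<Longrightarrow> \<exists>\<eta>\<in>\<Sigma>. norm (birkhoff_avg f \<eta> p - y) < e / 4"
      using y e4 unfolding approx_set_def by blast
    obtain C where C: "\<And>n \<xi> \<eta>. \<lbrakk>\<xi> \<in> \<Sigma>; \<eta> \<in> \<Sigma>; \<And>i. 0 \<le> i \<Longrightarrow> i < int n \<Longrightarrow> \<xi> i = \<eta> i\<rbrakk>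
      \<Longrightarrow> norm (birkhoff_sum f \<xi> n - birkhoff_sum f \<eta> n) \<le> (e / 4) * real n + C"
      using birkhoff_sum_close[OF e4] by blast
    \<comment> \<open>Collects the errors that do not grow with the length: one constant
      \<open>C\<close> for each of the two words, the value at the connecting letter, and rounding
      of the two word lengths by at most 1 each.\<close>
    define D where "D = 2 * C + B + norm x + norm y"
    \<comment> \<open>The surplus 2 leaves room for rounding and for the connecting letter, so that
      both word lengths still exceed \<open>m1\<close> and \<open>m2\<close>.\<close>
    obtain k1 :: nat where k1: "real k1 > (real m1 + 2) / u" using reals_Archimedean2 by blast
    obtain k2 :: nat where k2: "real k2 > (real m2 + 2) / v" using reals_Archimedean2 by blast
    obtain k3 :: nat where k3: "real k3 > 2 * \<bar>D\<bar> / e" using reals_Archimedean2 by blast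
    have "\<exists>\<eta>\<in>\<Sigma>. norm (birkhoff_avg f \<eta> p - (u *\<^sub>R x + v *\<^sub>R y)) < e" if p: "p \<ge> k1 + k2 + k3" for p
    proof -
      have "(real m1 + 2) / u < real p" using k1 p by linarith
      then have up: "u * real p > real m1 + 2" using uv by (simp add: field_simps)
      have "(real m2 + 2) / v < real p" using k2 p by linarith
      then have vp: "v * real p > real m2 + 2" using uv by (simp add: field_simps)
      have "2 * \<bar>D\<bar> / e < real p" using k3 p by linarith
      then have Dp: "D < (e / 2) * real p" using e by (simp add: field_simps)
      have "u * real p + v * real p = real p" using uv(3) by (metis distrib_right mult_1)
      define p1 where "p1 = nat \<lfloor>u * real p\<rfloor>"
      have p1: "real p1 \<le> u * real p" "u * real p < real p1 + 1"
        using up by (auto simp: p1_def)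
      \<comment> \<open>One position is reserved for the connecting letter. Together with rounding
        \<open>p1\<close> down this moves \<open>p2\<close> away from \<open>v * real p\<close> by
        at most 1.\<close>
      define p2 where "p2 = p - 1 - p1"
      have "real (Suc p1) \<le> real p" using p1 vp \<open>u * real p + v * real p = real p\<close> by simp
      then have p_eq: "p = Suc p1 + p2" by (simp add: p2_def)
      then have rp: "real p = real p1 + 1 + real p2" by simp
      have "p1 > m1" "p2 > m2"
        using p1 up vp rp \<open>u * real p + v * real p = real p\<close> by linarith+
      obtain \<xi> where \<xi>: "\<xi> \<in> \<Sigma>" "norm (birkhoff_avg f \<xi> p1 - x) < e / 4"
        using m1[of p1] \<open>p1 > m1\<close> by auto
      obtain \<eta> where \<eta>: "\<eta> \<in> \<Sigma>" "norm (birkhoff_avg f \<eta> p2 - y) < e / 4"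
        using m2[of p2] \<open>p2 > m2\<close> by auto
      obtain \<zeta> where \<zeta>: "\<zeta> \<in> \<Sigma>" "\<And>i. i < int p1 \<Longrightarrow> \<zeta> i = \<xi> i"
        "\<And>i. i \<ge> 0 \<Longrightarrow> (shift ^^ Suc p1) \<zeta> i = \<eta> i"
        using ex_glue[OF s \<xi>(1) \<eta>(1), of p1] by blast
      have 1: "norm (birkhoff_sum f \<zeta> p1 - birkhoff_sum f \<xi> p1) \<le> (e / 4) * real p1 + C"
        using \<zeta>(1,2) \<xi>(1) by (intro C) auto
      have 2: "norm (birkhoff_sum f ((shift ^^ Suc p1) \<zeta>) p2 - birkhoff_sum f \<eta> p2) \<le> (e / 4) * real p2 + C"
        using \<zeta>(3) \<eta>(1) shift_in_symbol_space[OF \<zeta>(1), of "Suc p1"] by (intro C) auto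
      have 3: "norm (birkhoff_sum f \<xi> p1 - real p1 *\<^sub>R x) \<le> (e / 4) * real p1"
        using norm_birkhoff_sum_approx[OF \<xi>(2)] \<open>p1 > m1\<close> by simp
      have 4: "norm (birkhoff_sum f \<eta> p2 - real p2 *\<^sub>R y) \<le> (e / 4) * real p2"
        using norm_birkhoff_sum_approx[OF \<eta>(2)] \<open>p2 > m2\<close> by simp
      have 5: "norm (f ((shift ^^ p1) \<zeta>)) \<le> B"
        by (intro bounded shift_in_symbol_space \<zeta>(1))
      have 6: "norm ((real p1 - u * real p) *\<^sub>R x) \<le> norm x"
        using p1 mult_right_mono[of "\<bar>real p1 - u * real p\<bar>" 1 "norm x"] by simp
      have 7: "norm ((real p2 - v * real p) *\<^sub>R y) \<le> norm y"
        using p1 rp \<open>u * real p + v * real p = real p\<close>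
          mult_right_mono[of "\<bar>real p2 - v * real p\<bar>" 1 "norm y"] by simp
      have "birkhoff_sum f \<zeta> p = birkhoff_sum f \<zeta> p1 + f ((shift ^^ p1) \<zeta>) + birkhoff_sum f ((shift ^^ Suc p1) \<zeta>) p2"
        unfolding p_eq birkhoff_sum_add by (simp add: birkhoff_sum_def)
      then have eq: "birkhoff_sum f \<zeta> p - real p *\<^sub>R (u *\<^sub>R x + v *\<^sub>R y)
        = (birkhoff_sum f \<zeta> p1 - birkhoff_sum f \<xi> p1) + (birkhoff_sum f \<xi> p1 - real p1 *\<^sub>R x)
        + f ((shift ^^ p1) \<zeta>)
        + (birkhoff_sum f ((shift ^^ Suc p1) \<zeta>) p2 - birkhoff_sum f \<eta> p2) + (birkhoff_sum f \<eta> p2 - real p2 *\<^sub>R y)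
        + (real p1 - u * real p) *\<^sub>R x + (real p2 - v * real p) *\<^sub>R y"
        by (simp add: scaleR_add_right scaleR_diff_left mult.commute)
      have "norm (birkhoff_sum f \<zeta> p - real p *\<^sub>R (u *\<^sub>R x + v *\<^sub>R y))
        \<le> ((e / 4) * real p1 + C) + (e / 4) * real p1 + B + ((e / 4) * real p2 + C) + (e / 4) * real p2 + norm x + norm y"
        unfolding eq by (intro norm_triangle_mono 1 2 3 4 5 6 7)
      also have "\<dots> = (e / 2) * (real p1 + real p2) + D" by (simp add: D_def field_simps)
      also have "\<dots> \<le> (e / 2) * real p + D" using rp e by simp
      also have "\<dots> < e * real p" using Dp by simp
      finally have "norm (birkhoff_avg f \<zeta> p - (u *\<^sub>R x + v *\<^sub>R y)) < e"
        using p_eq by (intro norm_birkhoff_avg_approx) auto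
      then show ?thesis using \<zeta>(1) by blast
    qed
    then show "\<exists>m. \<forall>p\<ge>m. \<exists>\<eta>\<in>\<Sigma>. norm (birkhoff_avg f \<eta> p - (u *\<^sub>R x + v *\<^sub>R y)) < e" by blast
  qed
  note interior_case = this
  show ?thesis
  proof (rule convexI)
    fix x y u v assume *: "x \<in> approx_set f \<Sigma>" "y \<in> approx_set f \<Sigma>" "0 \<le> u" "0 \<le> v" "u + v = (1::real)"
    then consider "u = 0" "v = 1" | "u = 1" "v = 0" | "u > 0" "v > 0" by linarith
    then show "u *\<^sub>R x + v *\<^sub>R y \<in> approx_set f \<Sigma>"
      by cases (use * interior_case in auto)
  qed
qed

text \<open>The appended word is so long that the old prefix no longer counts. The estimate is
  claimed for every sequence sharing the first \<open>q\<close> letters, so that it survives all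
  later extensions and passes to their limit.\<close>

lemma extend_approximation:
  assumes z: "z \<in> approx_set f \<Sigma>" and \<xi>: "\<xi> \<in> \<Sigma>" and e: "e > 0"
  obtains \<zeta> q where "\<zeta> \<in> \<Sigma>" "q > n" "\<And>i. i < int n \<Longrightarrow> \<zeta> i = \<xi> i"
    "\<And>\<zeta>'. \<lbrakk>\<zeta>' \<in> \<Sigma>; \<And>i. 0 \<le> i \<Longrightarrow> i < int q \<Longrightarrow> \<zeta>' i = \<zeta> i\<rbrakk> \<Longrightarrow> norm (birkhoff_avg f \<zeta>' q - z) < e"
proof -
  have e': "e / 8 > 0" using e by simp
  obtain m1 where m1: "m1 > 0"
    "\<And>n \<xi> \<eta>. \<lbrakk>m1 \<le> n; \<xi> \<in> \<Sigma>; \<eta> \<in> \<Sigma>; \<And>i. 0 \<le> i \<Longrightarrow> i < int n \<Longrightarrow> \<xi> i = \<eta> i\<rbrakk>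
    \<Longrightarrow> norm (birkhoff_avg f \<xi> n - birkhoff_avg f \<eta> n) < e / 8"
    using birkhoff_avg_close[OF e'] by blast
  obtain m2 where m2: "\<And>p. p \<ge> m2 \<Longrightarrow> \<exists>\<eta>\<in>\<Sigma>. norm (birkhoff_avg f \<eta> p - z) < e / 8"
    using z e' unfolding approx_set_def by blast
  \<comment> \<open>The prefix and its connecting letter contribute at most
    \<open>real (Suc n) * (B + norm z)\<close> to the deviation; \<open>k\<close> makes this less
    than \<open>(e / 4) * real p\<close>.\<close>
  obtain k :: nat where k: "real k > 4 * (real (Suc n) * (B + norm z)) / e" using reals_Archimedean2 by blast
  define p where "p = m1 + m2 + k"
  define q where "q = Suc n + p"
  obtain \<eta> where \<eta>: "\<eta> \<in> \<Sigma>" "norm (birkhoff_avg f \<eta> p - z) < e / 8"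
    using m2[of p] by (auto simp: p_def)
  obtain \<zeta> where \<zeta>: "\<zeta> \<in> \<Sigma>" "\<And>i. i < int n \<Longrightarrow> \<zeta> i = \<xi> i"
    "\<And>i. i \<ge> 0 \<Longrightarrow> (shift ^^ Suc n) \<zeta> i = \<eta> i"
    using ex_glue[OF s \<xi> \<eta>(1), of n] by blast
  let ?\<zeta> = "(shift ^^ Suc n) \<zeta>"
  have "norm (birkhoff_avg f ?\<zeta> p - birkhoff_avg f \<eta> p) < e / 8"
    using \<zeta>(3) \<eta>(1) shift_in_symbol_space[OF \<zeta>(1), of "Suc n"] by (intro m1(2)) (auto simp: p_def)
  then have "norm (birkhoff_avg f ?\<zeta> p - z) < e / 4"
    using \<eta>(2) norm_triangle_ineq[of "birkhoff_avg f ?\<zeta> p - birkhoff_avg f \<eta> p" "birkhoff_avg f \<eta> p - z"] by simp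
  then have 1: "norm (birkhoff_sum f ?\<zeta> p - real p *\<^sub>R z) \<le> (e / 4) * real p"
    using m1(1) by (intro norm_birkhoff_sum_approx) (auto simp: p_def)
  have eq: "birkhoff_sum f \<zeta> q - real q *\<^sub>R z
     = birkhoff_sum f \<zeta> (Suc n) + (birkhoff_sum f ?\<zeta> p - real p *\<^sub>R z) + (- real (Suc n)) *\<^sub>R z"
    unfolding q_def birkhoff_sum_add by (simp add: algebra_simps)
  have "norm ((- real (Suc n)) *\<^sub>R z) \<le> real (Suc n) * norm z"
    by (simp only: norm_scaleR abs_minus_cancel abs_of_nat)
  then have "norm (birkhoff_sum f \<zeta> q - real q *\<^sub>R z) \<le> real (Suc n) * B + (e / 4) * real p + real (Suc n) * norm z"
    unfolding eq by (intro norm_triangle_mono 1 norm_birkhoff_sum_le \<zeta>(1))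
  also have "\<dots> = real (Suc n) * (B + norm z) + (e / 4) * real p" by (simp add: algebra_simps)
  also have "\<dots> < (e / 4) * real p + (e / 4) * real p"
  proof -
    have "4 * (real (Suc n) * (B + norm z)) / e < real p" using k by (simp add: p_def)
    then show ?thesis using e by (simp add: field_simps del: of_nat_Suc)
  qed
  also have "\<dots> \<le> (e / 2) * real q" using e by (simp add: q_def)
  finally have 2: "norm (birkhoff_avg f \<zeta> q - z) < e / 2"
    by (intro norm_birkhoff_avg_approx) (auto simp: q_def)
  show ?thesis
  proof (rule that[OF \<zeta>(1)])
    show "q > n" by (simp add: q_def)
    fix \<zeta>' assume \<zeta>': "\<zeta>' \<in> \<Sigma>" "\<And>i. 0 \<le> i \<Longrightarrow> i < int q \<Longrightarrow> \<zeta>' i = \<zeta> i"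
    have "norm (birkhoff_avg f \<zeta>' q - birkhoff_avg f \<zeta> q) < e / 8"
      using \<zeta>' \<zeta>(1) by (intro m1(2)) (auto simp: q_def p_def)
    then show "norm (birkhoff_avg f \<zeta>' q - z) < e"
      using 2 e norm_triangle_ineq[of "birkhoff_avg f \<zeta>' q - birkhoff_avg f \<zeta> q" "birkhoff_avg f \<zeta> q - z"] by simp
  qed (use \<zeta> in auto)
qed

lemma approx_set_subset_general_rotation_set: "approx_set f \<Sigma> \<subseteq> general_rotation_set f \<Sigma>"
proof
  fix z assume z: "z \<in> approx_set f \<Sigma>"
  define good where "good k w \<longleftrightarrow> fst w \<in> \<Sigma> \<and> snd w > 0 \<and>
    (\<forall>\<zeta>\<in>\<Sigma>. (\<forall>i. 0 \<le> i \<and> i < int (snd w) \<longrightarrow> \<zeta> i = fst w i) \<longrightarrow>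
      norm (birkhoff_avg f \<zeta> (snd w) - z) < 1 / real (Suc k))"
    for k :: nat and w :: "(int \<Rightarrow> nat) \<times> nat"
  define extends where "extends w w' \<longleftrightarrow> snd w < snd w' \<and> (\<forall>i<int (snd w). fst w' i = fst w i)"
    for w w' :: "(int \<Rightarrow> nat) \<times> nat"
  have step: "\<exists>w'. good k w' \<and> extends w w'" if \<xi>: "fst w \<in> \<Sigma>" for w k
  proof -
    have pos: "1 / real (Suc k) > 0" by simp
    obtain \<zeta> q where "\<zeta> \<in> \<Sigma>" "q > snd w" "\<And>i. i < int (snd w) \<Longrightarrow> \<zeta> i = fst w i"
      "\<And>\<zeta>'. \<lbrakk>\<zeta>' \<in> \<Sigma>; \<And>i. 0 \<le> i \<Longrightarrow> i < int q \<Longrightarrow> \<zeta>' i = \<zeta> i\<rbrakk> \<Longrightarrow> norm (birkhoff_avg f \<zeta>' q - z) < 1 / real (Suc k)"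
      using extend_approximation[OF z \<xi> pos, where n = "snd w"] by blast
    then have "good k (\<zeta>, q) \<and> extends w (\<zeta>, q)" by (auto simp: good_def extends_def)
    then show ?thesis by blast
  qed
  obtain \<xi>0 where "\<xi>0 \<in> \<Sigma>"
    using z zero_less_one unfolding approx_set_def by blast
  then have "\<exists>w. good 0 w" using step[of "(\<xi>0, 0)" 0] by auto
  then have "\<exists>w. \<forall>k. good k (w k) \<and> extends (w k) (w (Suc k))"
  proof (rule dependent_nat_choice)
    fix w k assume "good k w"
    then have "fst w \<in> \<Sigma>" by (simp add: good_def)
    then show "\<exists>w'. good (Suc k) w' \<and> extends w w'" by (rule step)
  qed
  then obtain w where w: "\<And>k. good k (w k)" "\<And>k. extends (w k) (w (Suc k))"
    by blast
  define N where "N k = snd (w k)" for k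
  have N: "strict_mono N"
    using w(2) by (auto simp: strict_mono_Suc_iff N_def extends_def)
  have N_gt: "k < N k" for k
  proof (induction k)
    case 0
    then show ?case using w(1)[of 0] by (simp add: good_def N_def)
  next
    case (Suc k)
    then show ?case using strict_monoD[OF N, of k "Suc k"] by simp
  qed
  have agree: "fst (w l) i = fst (w k) i" if "k \<le> l" "i < int (N k)" for k l i
    using that(1)
  proof (induction l rule: dec_induct)
    case (step l)
    have "N k \<le> N l" using step N by (simp add: strict_mono_less_eq)
    then show ?case using step w(2)[of l] that(2) by (auto simp: extends_def N_def)
  qed simp
  \<comment> \<open>Since \<open>k < N k\<close>, stage \<open>nat i\<close> has already settled
    position \<open>i\<close>. For negative \<open>i\<close> this is stage 0, whose left half-line
    is never changed afterwards.\<close>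
  define \<zeta> where "\<zeta> i = fst (w (nat i)) i" for i
  have \<zeta>_eq: "\<zeta> i = fst (w k) i" if "i < int (N k)" for i k
  proof (cases "k \<le> nat i")
    case True
    then show ?thesis using agree[OF True that] by (simp add: \<zeta>_def)
  next
    case False
    have "i < int (N (nat i))" using N_gt[of "nat i"] by linarith
    then show ?thesis using agree[of "nat i" k i] False by (simp add: \<zeta>_def)
  qed
  have "\<zeta> \<in> \<Sigma>"
  proof -
    have "\<zeta> i \<in> {1..s} \<and> \<zeta> i \<noteq> \<zeta> (i + 1)" for i
    proof -
      let ?k = "nat (i + 1)"
      have "i + 1 < int (N ?k)" using N_gt[of ?k] by linarith
      then have "\<zeta> i = fst (w ?k) i" "\<zeta> (i + 1) = fst (w ?k) (i + 1)"
        using \<zeta>_eq[of i ?k] \<zeta>_eq[of "i + 1" ?k] by auto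
      moreover have "fst (w ?k) \<in> \<Sigma>" using w(1) by (simp add: good_def)
      ultimately show ?thesis using symbol_spaceD[of "fst (w ?k)"] by metis
    qed
    then show ?thesis by (simp add: symbol_space_def)
  qed
  have "norm (birkhoff_avg f \<zeta> (N k) - z) < 1 / real (Suc k)" for k
    using w(1)[of k] \<open>\<zeta> \<in> \<Sigma>\<close> \<zeta>_eq[of _ k] by (simp add: good_def N_def del: of_nat_Suc)
  then have "\<forall>k. norm (birkhoff_avg f \<zeta> (N k) - z) \<le> inverse (real (Suc k))"
    by (metis inverse_eq_divide less_imp_le)
  then have "(\<lambda>k. birkhoff_avg f \<zeta> (N k) - z) \<longlonglongrightarrow> 0"
    using LIMSEQ_inverse_real_of_nat by (rule_tac Lim_null_comparison) (auto intro: always_eventually)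
  then have lim: "(\<lambda>k. birkhoff_avg f \<zeta> (N k)) \<longlonglongrightarrow> z" by (simp add: LIM_zero_iff)
  define r where "r k = N k - 1" for k
  have "Suc (r k) = N k" for k using N_gt[of k] by (simp add: r_def)
  moreover have "strict_mono r"
  proof (rule strict_monoI)
    fix k l :: nat assume "k < l"
    then have "N k < N l" using N by (rule_tac strict_monoD)
    then show "r k < r l" using N_gt[of k] by (simp add: r_def)
  qed
  moreover have "(\<lambda>k. birkhoff_avg f \<zeta> (Suc (r k))) \<longlonglongrightarrow> z"
    using lim \<open>\<And>k. Suc (r k) = N k\<close> by simp
  ultimately show "z \<in> general_rotation_set f \<Sigma>"
    unfolding general_rotation_set_def using \<open>\<zeta> \<in> \<Sigma>\<close> by blast
qed

lemma general_rotation_set_eq_approx_set: "general_rotation_set f \<Sigma> = approx_set f \<Sigma>"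
proof
  have "{rotation_vector f \<eta> | \<eta>. \<eta> \<in> \<Sigma> \<and> periodic_seq \<eta>} \<subseteq> approx_set f \<Sigma>"
    using periodic_in_approx_set by blast
  then show "general_rotation_set f \<Sigma> \<subseteq> approx_set f \<Sigma>"
    using general_rotation_set_subset_closure closure_minimal[OF _ closed_approx_set] by blast
qed (rule approx_set_subset_general_rotation_set)

lemma rotation_set_structure:
  "convex (general_rotation_set f \<Sigma>) \<and>
   periodic_rotation_set f \<Sigma> \<subseteq> general_rotation_set f \<Sigma> \<and>
   general_rotation_set f \<Sigma> \<subseteq> closure (periodic_rotation_set f \<Sigma>)"
proof (intro conjI)
  show "convex (general_rotation_set f \<Sigma>)"
    by (simp add: general_rotation_set_eq_approx_set convex_approx_set)
  show "periodic_rotation_set f \<Sigma> \<subseteq> general_rotation_set f \<Sigma>"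
    unfolding general_rotation_set_eq_approx_set periodic_rotation_set_def
    by (rule hull_minimal) (auto intro: periodic_in_approx_set convex_approx_set)
  show "general_rotation_set f \<Sigma> \<subseteq> closure (periodic_rotation_set f \<Sigma>)"
    using general_rotation_set_subset_closure closure_mono[OF hull_subset]
    unfolding periodic_rotation_set_def by blast
qed

end

section \<open>Reflections at a convex body\<close>

lemma norm_times_sgn: "norm y *\<^sub>R sgn y = (y::'a::real_normed_vector)"
  by (cases "y = 0") (simp_all add: sgn_div_norm)

lemma inner_sgn_self: "y \<bullet> sgn y = norm (y::'a::real_inner)"
  by (cases "y = 0") (simp_all add: sgn_div_norm dot_square_norm power2_eq_square)

lemma in_closed_segment_if_sgn_eq:
  fixes a b p :: "'a::euclidean_space"
  assumes "sgn (p - a) = sgn (b - p)"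
  shows "p \<in> closed_segment a b"
proof -
  define \<alpha> \<beta> u where "\<alpha> = norm (p - a)" and "\<beta> = norm (b - p)" and "u = sgn (p - a)"
  have p: "p - a = \<alpha> *\<^sub>R u" "b - p = \<beta> *\<^sub>R u"
    unfolding \<alpha>_def \<beta>_def u_def using assms by (metis norm_times_sgn)+
  show ?thesis
  proof (cases "\<alpha> + \<beta> = 0")
    case True
    then have "\<alpha> = 0" by (metis \<alpha>_def \<beta>_def add_nonneg_eq_0_iff norm_ge_zero)
    then show ?thesis using p by simp
  next
    case False
    then have pos: "\<alpha> + \<beta> > 0" by (metis \<alpha>_def \<beta>_def add_nonneg_nonneg norm_ge_zero order_le_less)
    define t where "t = \<alpha> / (\<alpha> + \<beta>)"
    have "b - a = (\<alpha> + \<beta>) *\<^sub>R u" using p by (simp add: scaleR_add_left) (metis add_diff_cancel_left' diff_add_cancel diff_diff_eq2)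
    then have "t *\<^sub>R (b - a) = \<alpha> *\<^sub>R u" using pos by (simp add: t_def)
    then have "p = (1 - t) *\<^sub>R a + t *\<^sub>R b" using p by (simp add: algebra_simps)
    moreover have "0 \<le> t" "t \<le> 1" using pos by (auto simp: t_def \<alpha>_def \<beta>_def)
    ultimately show ?thesis unfolding in_segment by blast
  qed
qed

text \<open>Only distances and non-strict inequalities occur, so for a fixed set \<open>A\<close>
  the condition is closed in the three points.\<close>

definition minimal_reflection :: "'a::euclidean_space set \<Rightarrow> 'a \<Rightarrow> 'a \<Rightarrow> 'a \<Rightarrow> bool" where
  "minimal_reflection A a p b \<longleftrightarrow> (\<forall>x\<in>A. dist a p + dist p b \<le> dist a x + dist x b)"

text \<open>For \<open>p\<close> different from \<open>a\<close> and \<open>b\<close>, the vector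
  \<open>sgn (p - a) - sgn (b - p)\<close> is the gradient at \<open>p\<close> of the length of the
  path from \<open>a\<close> to \<open>b\<close> through \<open>p\<close>; this is the variational
  inequality for a constrained minimum.\<close>

definition critical_reflection :: "'a::euclidean_space set \<Rightarrow> 'a \<Rightarrow> 'a \<Rightarrow> 'a \<Rightarrow> bool" where
  "critical_reflection A a p b \<longleftrightarrow> (\<forall>x\<in>A. (sgn (p - a) - sgn (b - p)) \<bullet> (x - p) \<ge> 0)"

text \<open>The subgradient inequality of the norm, based at the far end \<open>y + h\<close>. It
  bounds the increase of length from above without differentiating the norm.\<close>

lemma norm_le_add_inner_sgn:
  fixes y h :: "'a::euclidean_space"
  shows "norm (y + h) \<le> norm y + h \<bullet> sgn (y + h)"
proof -
  have "y \<bullet> sgn (y + h) \<le> norm y * norm (sgn (y + h))" by (rule norm_cauchy_schwarz)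
  also have "\<dots> \<le> norm y" by (simp add: norm_sgn mult_left_le)
  finally have "y \<bullet> sgn (y + h) \<le> norm y" .
  moreover have "(y + h) \<bullet> sgn (y + h) = norm (y + h)"
    by (rule inner_sgn_self)
  ultimately show ?thesis by (simp add: inner_add_left)
qed

lemma minimal_imp_critical:
  fixes A :: "'a::euclidean_space set"
  assumes "minimal_reflection A a p b" "convex A" "p \<in> A" "p \<noteq> a" "p \<noteq> b"
  shows "critical_reflection A a p b"
  unfolding critical_reflection_def
proof
  fix x assume x: "x \<in> A"
  define h where "h = x - p"
  \<comment> \<open>\<open>t * g t\<close> bounds the increase of path length on moving from
    \<open>p\<close> to \<open>p + t *\<^sub>R h\<close>, so minimality makes \<open>g t\<close>
    nonnegative. Letting \<open>t\<close> tend to 0 uses continuity of \<open>sgn\<close> away from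
    0, hence \<open>p \<noteq> a\<close> and \<open>p \<noteq> b\<close>.\<close>
  define g where "g t = h \<bullet> sgn ((p - a) + t *\<^sub>R h) + h \<bullet> sgn ((p - b) + t *\<^sub>R h)" for t
  have g: "g t \<ge> 0" if t: "0 < t" "t < 1" for t
  proof -
    have "(1 - t) *\<^sub>R p + t *\<^sub>R x \<in> A"
      using assms(2,3) x t by (auto intro: convexD_alt)
    then have "p + t *\<^sub>R h \<in> A" by (simp add: h_def algebra_simps)
    then have "dist a p + dist p b \<le> dist a (p + t *\<^sub>R h) + dist (p + t *\<^sub>R h) b"
      using assms(1) by (auto simp: minimal_reflection_def)
    also have "\<dots> = norm ((p - a) + t *\<^sub>R h) + norm ((p - b) + t *\<^sub>R h)"
      by (simp add: dist_norm norm_minus_commute[of a] algebra_simps)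
    also have "\<dots> \<le> norm (p - a) + (t *\<^sub>R h) \<bullet> sgn ((p - a) + t *\<^sub>R h)
       + (norm (p - b) + (t *\<^sub>R h) \<bullet> sgn ((p - b) + t *\<^sub>R h))"
      by (intro add_mono norm_le_add_inner_sgn)
    finally have "0 \<le> t * g t" by (simp add: g_def dist_norm norm_minus_commute[of a] algebra_simps)
    then show ?thesis using t by (simp add: zero_le_mult_iff)
  qed
  have "((\<lambda>t. p - a + t *\<^sub>R h) \<longlongrightarrow> p - a + 0 *\<^sub>R h) (at_right 0)"
    "((\<lambda>t. p - b + t *\<^sub>R h) \<longlongrightarrow> p - b + 0 *\<^sub>R h) (at_right 0)"
    by (intro tendsto_intros)+
  then have "(g \<longlongrightarrow> h \<bullet> sgn (p - a) + h \<bullet> sgn (p - b)) (at_right 0)"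
    unfolding g_def using assms(4,5) by (intro tendsto_intros) auto
  moreover have "eventually (\<lambda>t. 0 \<le> g t) (at_right 0)"
    using g eventually_at_right[of 0 1] by (metis zero_less_one)
  ultimately have "0 \<le> h \<bullet> sgn (p - a) + h \<bullet> sgn (p - b)"
    by (rule tendsto_lowerbound) simp
  moreover have "sgn (p - b) = - sgn (b - p)" by (metis minus_diff_eq sgn_minus)
  ultimately show "0 \<le> (sgn (p - a) - sgn (b - p)) \<bullet> (x - p)"
    by (simp add: h_def inner_diff inner_commute algebra_simps)
qed

section \<open>Monotonicity and rigidity behind uniqueness\<close>

lemma norm_diff_unit_vectors_square:
  fixes u v :: "'a::euclidean_space"
  assumes "norm u = 1" "norm v = 1"
  shows "(norm (u - v))\<^sup>2 = 2 * (1 - u \<bullet> v)"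
proof -
  have "u \<bullet> u = 1" "v \<bullet> v = 1" using assms by (simp_all add: dot_square_norm)
  then show ?thesis by (simp add: power2_norm_eq_inner inner_diff inner_commute)
qed

text \<open>The gradient of the norm is monotone, and here the defect is explicit: the inner product
  equals the sum of the two norms times one minus the cosine of the angle between the
  vectors.\<close>

lemma sgn_strictly_monotone:
  fixes r r' :: "'a::euclidean_space"
  assumes "norm r \<ge> d" "norm r' \<ge> d" "d > 0"
  shows "(sgn r' - sgn r) \<bullet> (r' - r) \<ge> d * (norm (sgn r' - sgn r))\<^sup>2"
proof -
  have n: "norm (sgn r) = 1" "norm (sgn r') = 1" using assms by (auto simp: norm_sgn)
  then have s: "sgn r \<bullet> sgn r = 1" "sgn r' \<bullet> sgn r' = 1" by (simp_all add: dot_square_norm)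
  have "(sgn r' - sgn r) \<bullet> (r' - r)
     = (sgn r' - sgn r) \<bullet> (norm r' *\<^sub>R sgn r' - norm r *\<^sub>R sgn r)" by (simp add: norm_times_sgn)
  also have "\<dots> = (norm r + norm r') * (1 - sgn r' \<bullet> sgn r)"
    using s by (simp add: inner_diff inner_commute algebra_simps)
  also have "\<dots> \<ge> (2 * d) * (1 - sgn r' \<bullet> sgn r)"
    using assms norm_cauchy_schwarz[of "sgn r'" "sgn r"] n by (intro mult_right_mono) auto
  finally show ?thesis unfolding norm_diff_unit_vectors_square[OF n(2,1)] by (simp add: mult_ac)
qed

text \<open>A bounded solution over the whole of \<open>\<int>\<close> of a Riccati-type inequality vanishes: a positive
  value would force blow-up to the right, a negative one blow-up to the left.\<close>

lemma bounded_riccati_zero: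
  fixes c :: "int \<Rightarrow> real"
  assumes step: "\<And>i. c (i + 1) \<ge> c i + k * (c i)\<^sup>2" and k: "k > 0" and bd: "\<And>i. \<bar>c i\<bar> \<le> C"
  shows "c i = 0"
proof (rule ccontr)
  assume "c i \<noteq> 0"
  \<comment> \<open>Moving away from \<open>i\<close> in the direction of blow-up,
    \<open>\<bar>c\<bar>\<close> never drops below its value at \<open>i\<close>, so each step gains
    at least \<open>e\<close>, and \<open>n\<close> steps exceed the available range
    \<open>2 * C\<close>.\<close>
  define e where "e = k * (c i)\<^sup>2"
  have e: "e > 0" using \<open>c i \<noteq> 0\<close> k by (simp add: e_def)
  obtain n :: nat where n: "real n * e > 2 * C" using e reals_Archimedean3 by blast
  consider "c i > 0" | "c i < 0" using \<open>c i \<noteq> 0\<close> by linarith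
  then show False
  proof cases
    case 1
    have "c (i + int m) \<ge> c i + real m * e" for m
    proof (induction m)
      case (Suc m)
      then have "c (i + int m) \<ge> c i" using e by (smt (verit) mult_nonneg_nonneg of_nat_0_le_iff)
      then have "k * (c (i + int m))\<^sup>2 \<ge> e" unfolding e_def using 1 k by (simp add: power_mono)
      then show ?case using Suc step[of "i + int m"] by (simp add: algebra_simps)
    qed simp
    from this[of n] show False using n bd[of i] bd[of "i + int n"] by linarith
  next
    case 2
    have "c (i - int m) \<le> c i - real m * e" for m
    proof (induction m)
      case (Suc m)
      have "c (i - int (Suc m)) \<le> c (i - int m)"
        using step[of "i - int (Suc m)"] k by (smt (verit) mult_nonneg_nonneg of_nat_Suc zero_le_power2)
      then have "c (i - int (Suc m)) \<le> c i" using Suc e by (smt (verit) mult_nonneg_nonneg of_nat_0_le_iff)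
      then have "(c i)\<^sup>2 \<le> (c (i - int (Suc m)))\<^sup>2" using 2 by (simp add: abs_le_square_iff[symmetric])
      then have "k * (c (i - int (Suc m)))\<^sup>2 \<ge> e" unfolding e_def using k by simp
      then show ?case using Suc step[of "i - int (Suc m)"] by (simp add: algebra_simps)
    qed simp
    from this[of n] show False using n bd[of i] bd[of "i - int n"] by linarith
  qed
qed

text \<open>Both points would lie on the supporting hyperplane orthogonal to \<open>m\<close>. Their
  midpoint is interior, so a small step from it against \<open>m\<close> stays in \<open>A\<close>
  but leaves the half-space.\<close>

lemma strictly_convex_critical_unique:
  fixes A :: "'a::euclidean_space set"
  assumes A: "strictly_convex A" and pq: "p \<in> A" "q \<in> A" and m: "m \<noteq> 0" "m \<bullet> (q - p) = 0"
    and crit: "\<forall>x\<in>A. m \<bullet> (x - p) \<ge> 0"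
  shows "q = p"
proof (rule ccontr)
  assume "q \<noteq> p"
  then have "midpoint p q \<in> interior A"
    using A pq unfolding strictly_convex_def by (metis midpoint_in_open_segment subsetD)
  then obtain e where e: "e > 0" "cball (midpoint p q) e \<subseteq> A"
    unfolding mem_interior_cball by blast
  define x where "x = midpoint p q - (e / norm m) *\<^sub>R m"
  have "x \<in> A" using e m(1) by (auto simp: x_def dist_norm intro!: subsetD[OF e(2)])
  then have "m \<bullet> (x - p) \<ge> 0" using crit by blast
  moreover have "midpoint p q - p = (1/2) *\<^sub>R (q - p)" by (simp add: midpoint_def algebra_simps flip: scaleR_add_left)
  then have "m \<bullet> (midpoint p q - p) = 0" using m(2) by simp
  moreover have "x - p = (midpoint p q - p) - (e / norm m) *\<^sub>R m" by (simp add: x_def)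
  ultimately have "(e / norm m) * (m \<bullet> m) \<le> 0" by (simp add: inner_diff_right)
  moreover have "(e / norm m) * (m \<bullet> m) > 0" using e m(1) by simp
  ultimately show False by linarith
qed

lemma descent_direction_enters:
  fixes A :: "'a::euclidean_space set"
  assumes U: "open U" "p \<in> U" and f: "(f has_derivative (\<lambda>h. g \<bullet> h)) (at p)"
    and fp: "f p \<le> 0" and A: "A \<inter> U = {x\<in>U. f x \<le> 0}"
    and h: "g \<bullet> h < 0"
  shows "\<exists>e>0. \<forall>t. 0 < t \<and> t < e \<longrightarrow> p + t *\<^sub>R h \<in> A"
proof -
  have "((\<lambda>t. p + t *\<^sub>R h) has_derivative (\<lambda>t. t *\<^sub>R h)) (at 0)"
    by (auto intro!: derivative_eq_intros)
  then have "((f \<circ> (\<lambda>t. p + t *\<^sub>R h)) has_derivative ((\<lambda>h. g \<bullet> h) \<circ> (\<lambda>t. t *\<^sub>R h))) (at (0::real))"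
    using f by (intro diff_chain_at) auto
  moreover have "((\<lambda>h. g \<bullet> h) \<circ> (\<lambda>t. t *\<^sub>R h)) = (*) (g \<bullet> h)"
    by (auto simp: o_def)
  ultimately have "((\<lambda>t. f (p + t *\<^sub>R h)) has_real_derivative (g \<bullet> h)) (at 0)"
    unfolding has_field_derivative_def by (simp add: o_def)
  from DERIV_neg_dec_right[OF this h]
  obtain d where d: "d > 0" "\<And>t. 0 < t \<Longrightarrow> t < d \<Longrightarrow> f (p + t *\<^sub>R h) < f p"
    by auto
  have "((\<lambda>t. p + t *\<^sub>R h) \<longlongrightarrow> p + 0 *\<^sub>R h) (at_right 0)" by (intro tendsto_intros)
  then have "eventually (\<lambda>t. p + t *\<^sub>R h \<in> U) (at_right 0)"
    using U by (intro topological_tendstoD) auto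
  then obtain d' where d': "d' > 0" "\<And>t. 0 < t \<Longrightarrow> t < d' \<Longrightarrow> p + t *\<^sub>R h \<in> U"
    unfolding eventually_at_right[OF zero_less_one] by auto
  have "p + t *\<^sub>R h \<in> A" if "0 < t" "t < min d d'" for t
  proof -
    have "p + t *\<^sub>R h \<in> U" "f (p + t *\<^sub>R h) \<le> 0" using d(2)[of t] d'(2)[of t] that fp by auto
    then show ?thesis using A by blast
  qed
  then show ?thesis using d(1) d'(1) by (metis min_less_iff_conj)
qed

text \<open>At a smooth boundary point the supporting hyperplane is unique, so a ray that leaves the body
  cannot start on its inner side.\<close>

lemma ray_outside_imp_inner_normal_nonneg:
  fixes A :: "'a::euclidean_space set"
  assumes C2: "C2_boundary A" and p: "p \<in> frontier A" "p \<in> A" and n: "outer_normal A p n"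
    and ray: "\<forall>e>0. \<exists>t. 0 < t \<and> t < e \<and> p + t *\<^sub>R v \<notin> A"
  shows "v \<bullet> n \<ge> 0"
proof -
  from C2[unfolded C2_boundary_def, rule_format, OF p(1)]
  obtain U f G where U: "open U" "p \<in> U" "\<forall>x\<in>U. (f has_derivative (\<lambda>h. G x \<bullet> h)) (at x)"
    "\<forall>x\<in>U. G x \<noteq> 0" "A \<inter> U = {x\<in>U. f x \<le> 0}"
    by (elim exE conjE) (rule that)
  define g where "g = G p"
  have "g \<noteq> 0" using U(2,4) unfolding g_def by blast
  have "(f has_derivative (\<lambda>h. g \<bullet> h)) (at p)" using U(2,3) unfolding g_def by blast
  moreover have "f p \<le> 0" using U(2,5) p(2) by blast
  ultimately have inward: "\<exists>e>0. \<forall>t. 0 < t \<and> t < e \<longrightarrow> p + t *\<^sub>R h \<in> A" if "g \<bullet> h < 0" for h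
    using descent_direction_enters[OF U(1,2) _ _ U(5)] that by blast
  have n1: "norm n = 1" and sup: "\<And>x. x \<in> A \<Longrightarrow> (x - p) \<bullet> n \<le> 0"
    using n by (auto simp: outer_normal_def)
  \<comment> \<open>Otherwise the direction \<open>n - sgn g\<close> has negative product with
    \<open>g\<close>, so it enters the body, and positive product with \<open>n\<close>, so it
    leaves the supporting half-space.\<close>
  have "n = sgn g"
  proof (rule ccontr)
    assume "n \<noteq> sgn g"
    then have "(norm (n - sgn g))\<^sup>2 > 0" by simp
    moreover have "norm (sgn g) = 1" using \<open>g \<noteq> 0\<close> by (simp add: norm_sgn)
    ultimately have lt: "n \<bullet> sgn g < 1"
      using norm_diff_unit_vectors_square[OF n1, of "sgn g"] by simp
    have "g \<bullet> n = norm g * (n \<bullet> sgn g)"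
      by (metis inner_commute inner_scaleR_right norm_times_sgn)
    moreover have "g \<bullet> sgn g = norm g" by (rule inner_sgn_self)
    ultimately have "g \<bullet> (n - sgn g) = norm g * (n \<bullet> sgn g - 1)"
      by (simp add: inner_diff_right algebra_simps)
    then have "g \<bullet> (n - sgn g) < 0" using lt \<open>g \<noteq> 0\<close> by (simp add: mult_pos_neg)
    then obtain e where e: "e > 0" "\<And>t. 0 < t \<Longrightarrow> t < e \<Longrightarrow> p + t *\<^sub>R (n - sgn g) \<in> A"
      using inward by blast
    have "p + (e/2) *\<^sub>R (n - sgn g) \<in> A" using e by simp
    from sup[OF this] have "(n - sgn g) \<bullet> n \<le> 0" using e(1) by (simp add: mult_le_0_iff)
    moreover have "n \<bullet> n = 1" using n1 by (simp add: dot_square_norm)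
    ultimately show False using lt by (simp add: inner_diff inner_commute)
  qed
  show ?thesis
  proof (rule ccontr)
    assume "\<not> v \<bullet> n \<ge> 0"
    then have "g \<bullet> v < 0"
      using \<open>n = sgn g\<close> \<open>g \<noteq> 0\<close> by (metis inner_commute inner_scaleR_right norm_times_sgn mult_pos_neg not_le zero_less_norm_iff)
    then show False using inward ray by blast
  qed
qed

section \<open>Orbits of open billiards\<close>

text \<open>Tychonoff's theorem, the source of compactness for sequences of bounce points.\<close>

lemma compact_pointwise_constrained_functions:
  fixes A :: "'i \<Rightarrow> 'b::topological_space set"
  assumes "\<And>i. compact (A i)"
  shows "compact {q. \<forall>i. q i \<in> A i}"
proof -
  have "compactin (product_topology (\<lambda>_. euclidean) UNIV) (PiE UNIV A)"
    using assms by (simp add: compactin_PiE)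
  moreover have "PiE UNIV A = {q. \<forall>i. q i \<in> A i}" by (auto simp: PiE_def Pi_def)
  ultimately show ?thesis by (simp add: euclidean_product_topology)
qed

locale open_billiard_table =
  fixes K :: "nat \<Rightarrow> 'a::euclidean_space set" and s :: nat
  assumes open_billiard: "open_billiard K s"
begin

lemma obstacles:
  assumes "i \<in> {1..s}"
  shows "compact (K i)" "closed (K i)" "strictly_convex (K i)" "convex (K i)" "C2_boundary (K i)"
    "K i \<noteq> {}"
proof -
  have *: "compact (K i) \<and> interior (K i) \<noteq> {} \<and> strictly_convex (K i) \<and> C2_boundary (K i)"
    by (rule bspec[OF conjunct1[OF open_billiard[unfolded open_billiard_def]] assms])
  then show "compact (K i)" "strictly_convex (K i)" "C2_boundary (K i)" by simp_all
  then show "closed (K i)" "convex (K i)" by (simp_all add: compact_imp_closed strictly_convex_def)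
  show "K i \<noteq> {}" using * by auto
qed

lemma disjoint_obstacles: "\<lbrakk>i \<in> {1..s}; j \<in> {1..s}; i \<noteq> j\<rbrakk> \<Longrightarrow> K i \<inter> K j = {}"
  using conjunct1[OF conjunct2[OF open_billiard[unfolded open_billiard_def]]] by simp

lemma no_eclipse:
  "\<lbrakk>i \<in> {1..s}; j \<in> {1..s}; k \<in> {1..s}; i \<noteq> j; j \<noteq> k; i \<noteq> k\<rbrakk> \<Longrightarrow> convex hull (K i \<union> K j) \<inter> K k = {}"
  using conjunct2[OF conjunct2[OF open_billiard[unfolded open_billiard_def]]] by simp

section \<open>Itineraries and the geometry forced by the no-eclipse condition\<close>

definition itinerary :: "(int \<Rightarrow> nat) \<Rightarrow> (int \<Rightarrow> 'a) \<Rightarrow> bool" where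
  "itinerary \<xi> q \<longleftrightarrow> \<xi> \<in> symbol_space s \<and> (\<forall>i. q i \<in> K (\<xi> i))"

lemma itineraryD:
  assumes "itinerary \<xi> q"
  shows "\<xi> i \<in> {1..s}" "\<xi> i \<noteq> \<xi> (i + 1)" "\<xi> (i - 1) \<noteq> \<xi> i" "q i \<in> K (\<xi> i)"
  using assms symbol_spaceD[of \<xi> s] symbol_spaceD(2)[of \<xi> s "i - 1"] by (auto simp: itinerary_def)

lemma itinerary_neq: "itinerary \<xi> q \<Longrightarrow> q i \<noteq> q (i + 1)"
  using disjoint_obstacles[of "\<xi> i" "\<xi> (i + 1)"] itineraryD[of \<xi> q] by (metis disjoint_iff)

text \<open>The indices need not be adjacent, so both symbols may coincide, as when an orbit bounces
  back. Then convexity and disjointness replace no-eclipse.\<close>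

lemma segment_disjoint_obstacle:
  assumes "itinerary \<xi> q" "k \<in> {1..s}" "k \<noteq> \<xi> i" "k \<noteq> \<xi> j"
  shows "closed_segment (q i) (q j) \<inter> K k = {}"
proof (cases "\<xi> i = \<xi> j")
  case True
  then have "closed_segment (q i) (q j) \<subseteq> K (\<xi> i)"
    using itineraryD[OF assms(1)] obstacles(4) by (metis closed_segment_subset)
  then show ?thesis using disjoint_obstacles[of "\<xi> i" k] itineraryD(1)[OF assms(1), of i] assms by blast
next
  case False
  have "q i \<in> convex hull (K (\<xi> i) \<union> K (\<xi> j))" "q j \<in> convex hull (K (\<xi> i) \<union> K (\<xi> j))"
    using itineraryD(4)[OF assms(1)] by (auto intro: hull_inc)
  then have "closed_segment (q i) (q j) \<subseteq> convex hull (K (\<xi> i) \<union> K (\<xi> j))"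
    by (intro closed_segment_subset) auto
  then show ?thesis
    using no_eclipse[of "\<xi> i" "\<xi> j" k] False itineraryD(1)[OF assms(1)] assms by blast
qed

text \<open>An unchanged direction would put the bounce point on the segment between its neighbours,
  against no-eclipse. So the change of direction is nonzero and can serve as a normal.\<close>

lemma direction_changes:
  assumes "itinerary \<xi> q"
  shows "sgn (q i - q (i - 1)) \<noteq> sgn (q (i + 1) - q i)"
proof
  assume "sgn (q i - q (i - 1)) = sgn (q (i + 1) - q i)"
  then have "q i \<in> closed_segment (q (i - 1)) (q (i + 1))" by (rule in_closed_segment_if_sgn_eq)
  then show False
    using segment_disjoint_obstacle[OF assms, of "\<xi> i" "i - 1" "i + 1"] itineraryD[OF assms, of i] by auto
qed

lemma obstacle_gap:
  obtains d where "d > 0"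
    "\<And>i j x y. \<lbrakk>i \<in> {1..s}; j \<in> {1..s}; i \<noteq> j; x \<in> K i; y \<in> K j\<rbrakk> \<Longrightarrow> d \<le> norm (x - y)"
proof -
  define P where "P = {(i, j). i \<in> {1..s} \<and> j \<in> {1..s} \<and> i \<noteq> j}"
  \<comment> \<open>A finite union of compact difference sets avoiding 0; its distance from 0 bounds
    all flight lengths from below.\<close>
  define D where "D = (\<Union>(i, j)\<in>P. {x - y |x y. x \<in> K i \<and> y \<in> K j})"
  have "finite P" by (rule finite_subset[of _ "{1..s} \<times> {1..s}"]) (auto simp: P_def)
  then have "compact D" unfolding D_def
    by (rule compact_UN) (auto simp: P_def intro!: compact_differences obstacles(1))
  moreover have "0 \<notin> D" using disjoint_obstacles by (fastforce simp: D_def P_def)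
  ultimately obtain d where d: "d > 0" "\<And>z. z \<in> D \<Longrightarrow> d \<le> dist 0 z"
    using separate_point_closed[of D 0] compact_imp_closed by blast
  have "d \<le> norm (x - y)" if "i \<in> {1..s}" "j \<in> {1..s}" "i \<noteq> j" "x \<in> K i" "y \<in> K j" for i j x y
    using d(2)[of "x - y"] that by (fastforce simp: D_def P_def)
  then show ?thesis using that d(1) by blast
qed

lemma obstacle_bounded:
  obtains B where "B > 0" "\<And>i x. i \<in> {1..s} \<Longrightarrow> x \<in> K i \<Longrightarrow> norm x \<le> B"
proof -
  have "bounded (\<Union>i\<in>{1..s}. K i)" 
    using obstacles(1) compact_imp_bounded by (intro bounded_UN finite_atLeastAtMost ballI) blast
  then show ?thesis using that by (auto simp: bounded_pos)
qed

section \<open>Critical orbits: uniqueness and equivalence with billiard orbits\<close>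

definition critical_orbit :: "(int \<Rightarrow> nat) \<Rightarrow> (int \<Rightarrow> 'a) \<Rightarrow> bool" where
  "critical_orbit \<xi> q \<longleftrightarrow> itinerary \<xi> q \<and>
     (\<forall>i. critical_reflection (K (\<xi> i)) (q (i - 1)) (q i) (q (i + 1)))"

text \<open>For two critical orbits with displacements \<open>D\<close> and direction differences \<open>w\<close>, the quantity
  \<open>w i \<bullet> D i\<close> is nondecreasing in \<open>i\<close>: reflections increase it by criticality, free flights by
  convexity of the norm, the latter by at least a multiple of its square.\<close>

lemma critical_orbit_unique:
  assumes q: "critical_orbit \<xi> q" and q': "critical_orbit \<xi> q'"
  shows "q' = q"
proof -
  have it: "itinerary \<xi> q" "itinerary \<xi> q'" using q q' by (auto simp: critical_orbit_def)
  obtain d where d: "d > 0"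
    "\<And>i j x y. \<lbrakk>i \<in> {1..s}; j \<in> {1..s}; i \<noteq> j; x \<in> K i; y \<in> K j\<rbrakk> \<Longrightarrow> d \<le> norm (x - y)"
    using obstacle_gap by blast
  obtain B where B: "B > 0" "\<And>i x. i \<in> {1..s} \<Longrightarrow> x \<in> K i \<Longrightarrow> norm x \<le> B"
    using obstacle_bounded by blast
  define u where "u i = sgn (q (i + 1) - q i)" for i
  define u' where "u' i = sgn (q' (i + 1) - q' i)" for i
  define w where "w i = u' i - u i" for i
  define D where "D i = q' i - q i" for i
  define c where "c i = w i \<bullet> D i" for i
  have crit: "(u (i - 1) - u i) \<bullet> (x - q i) \<ge> 0" "(u' (i - 1) - u' i) \<bullet> (x - q' i) \<ge> 0"
    if "x \<in> K (\<xi> i)" for x i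
    using q q' that by (auto simp: critical_orbit_def critical_reflection_def u_def u'_def)
  \<comment> \<open>Each orbit is tested at the bounce point of the other on the same obstacle, and
    the two inequalities are added.\<close>
  have reflect: "w i \<bullet> D (i + 1) \<le> c (i + 1)" for i
    using crit(1)[of "q' (i + 1)" "i + 1"] crit(2)[of "q (i + 1)" "i + 1"]
      itineraryD(4)[OF it(1)] itineraryD(4)[OF it(2)]
    by (simp add: c_def w_def D_def inner_diff algebra_simps)
  have flight: "w i \<bullet> D (i + 1) \<ge> c i + d * (norm (w i))\<^sup>2" for i
  proof -
    have "norm (q (i + 1) - q i) \<ge> d" "norm (q' (i + 1) - q' i) \<ge> d"
      using d(2)[of "\<xi> (i + 1)" "\<xi> i"] itineraryD[OF it(1)] itineraryD[OF it(2)] by metis+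
    from sgn_strictly_monotone[OF this d(1)]
    have "d * (norm (w i))\<^sup>2 \<le> w i \<bullet> ((q' (i + 1) - q' i) - (q (i + 1) - q i))"
      by (simp add: w_def u_def u'_def)
    also have "\<dots> = w i \<bullet> D (i + 1) - c i" by (simp add: c_def D_def inner_diff_right)
    finally show ?thesis by simp
  qed
  have D_le: "norm (D i) \<le> 2 * B" for i
    using B(2)[OF itineraryD(1,4)[OF it(1)], of i] B(2)[OF itineraryD(1,4)[OF it(2)], of i]
      norm_triangle_ineq4[of "q' i" "q i"] by (simp add: D_def)
  have w_le: "norm (w i) \<le> 2" for i
    using norm_triangle_ineq4[of "u' i" "u i"] by (simp add: w_def u_def u'_def norm_sgn split: if_splits)
  have c_le: "\<bar>c i\<bar> \<le> norm (w i) * (2 * B)" for i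
    unfolding c_def by (rule order_trans[OF Cauchy_Schwarz_ineq2]) (simp add: D_le mult_left_mono)
  \<comment> \<open>As \<open>\<bar>c i\<bar>\<close> is at most \<open>2 * B * norm (w i)\<close>,
    the gain \<open>d * (norm (w i))\<^sup>2\<close> in free flight dominates
    \<open>(c i)\<^sup>2\<close> with factor \<open>d / (2 * B)\<^sup>2\<close>. The bound
    \<open>4 * B\<close> combines \<open>norm (w i) \<le> 2\<close> with
    \<open>norm (D i) \<le> 2 * B\<close>.\<close>
  have c0: "c i = 0" for i
  proof (rule bounded_riccati_zero[where c = c and k = "d / (2 * B)\<^sup>2" and C = "4 * B"])
    show "d / (2 * B)\<^sup>2 > 0" using d(1) B(1) by simp
    fix i
    have "norm (w i) * (2 * B) \<le> 2 * (2 * B)" using w_le B(1) by (intro mult_right_mono) auto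
    then show "\<bar>c i\<bar> \<le> 4 * B" using c_le[of i] by linarith
    have "(c i)\<^sup>2 \<le> (norm (w i) * (2 * B))\<^sup>2" using c_le[of i] by (metis abs_ge_zero power2_abs power_mono)
    then have "d * (c i)\<^sup>2 \<le> d * ((norm (w i))\<^sup>2 * (2 * B)\<^sup>2)"
      using d(1) by (simp only: power_mult_distrib) (rule mult_left_mono, auto)
    then have "d * (c i)\<^sup>2 / (2 * B)\<^sup>2 \<le> d * (norm (w i))\<^sup>2"
      using B(1) by (subst pos_divide_le_eq) (auto simp: mult_ac)
    then show "c i + d / (2 * B)\<^sup>2 * (c i)\<^sup>2 \<le> c (i + 1)"
      using reflect[of i] flight[of i] by simp
  qed
  have w0: "w i = 0" for i
  proof -
    have "d * (norm (w i))\<^sup>2 \<le> 0" using reflect[of i] flight[of i] c0 by simp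
    then show ?thesis using d(1) by (simp add: mult_le_0_iff)
  qed
  \<comment> \<open>With equal directions the two criticality inequalities are opposite, so the
    displacement is orthogonal to the common change of direction.\<close>
  have "q' i = q i" for i
  proof (rule strictly_convex_critical_unique)
    show "strictly_convex (K (\<xi> i))" using obstacles(3) itineraryD(1)[OF it(1)] by blast
    show "q i \<in> K (\<xi> i)" "q' i \<in> K (\<xi> i)" using itineraryD(4) it by blast+
    show "u (i - 1) - u i \<noteq> 0" using direction_changes[OF it(1), of i] by (simp add: u_def)
    show "\<forall>x\<in>K (\<xi> i). (u (i - 1) - u i) \<bullet> (x - q i) \<ge> 0" using crit(1) by blast
    have "u' = u" using w0 by (auto simp: w_def)
    then show "(u (i - 1) - u i) \<bullet> (q' i - q i) = 0"
      using crit(1)[of "q' i" i] crit(2)[of "q i" i] itineraryD(4)[OF it(1)] itineraryD(4)[OF it(2)]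
      by (simp add: inner_diff_right order_antisym)
  qed
  then show ?thesis by blast
qed

text \<open>The law of reflection makes \<open>u - v\<close> equal to
  \<open>2 * (u \<bullet> n)\<close> times \<open>n\<close>, so criticality reduces to
  \<open>u \<bullet> n \<le> 0\<close>. The formula alone leaves this sign open; it follows from the
  outgoing segment avoiding the obstacle.\<close>

lemma billiard_orbit_imp_critical:
  assumes \<xi>: "\<xi> \<in> symbol_space s" and q: "billiard_orbit K s \<xi> q"
  shows "critical_orbit \<xi> q"
  unfolding critical_orbit_def
proof (intro conjI allI)
  have front: "q i \<in> frontier (K (\<xi> i))" for i using q by (auto simp: billiard_orbit_def)
  have inK: "q i \<in> K (\<xi> i)" for i
    using front[of i] obstacles(2) symbol_spaceD(1)[OF \<xi>] by (metis frontier_subset_closed subsetD)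
  then show "itinerary \<xi> q" using \<xi> by (auto simp: itinerary_def)
  fix i
  define u v where "u = sgn (q i - q (i - 1))" and "v = sgn (q (i + 1) - q i)"
  obtain n where n: "outer_normal (K (\<xi> i)) (q i) n" and v: "v = u - (2 * (u \<bullet> n)) *\<^sub>R n"
    using q unfolding billiard_orbit_def u_def v_def by blast
  have "n \<bullet> n = 1" using n by (simp add: outer_normal_def dot_square_norm)
  have "v \<bullet> n \<ge> 0"
  proof (rule ray_outside_imp_inner_normal_nonneg[OF _ front inK n])
    show "C2_boundary (K (\<xi> i))" using obstacles(5) symbol_spaceD(1)[OF \<xi>] by blast
    show "\<forall>e>0. \<exists>t. 0 < t \<and> t < e \<and> q i + t *\<^sub>R v \<notin> K (\<xi> i)"
    proof (intro allI impI)
      fix e :: real assume "e > 0"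
      define r where "r = norm (q (i + 1) - q i)"
      have "q i \<noteq> q (i + 1)" using q unfolding billiard_orbit_def by blast
      then have r: "r > 0" by (simp add: r_def)
      define t where "t = min e r / 2"
      have t: "0 < t" "t < e" "t < r" using \<open>e > 0\<close> r by (auto simp: t_def)
      have "q (i + 1) - q i = r *\<^sub>R v" by (simp add: r_def v_def norm_times_sgn)
      then have "(t / r) *\<^sub>R (q (i + 1) - q i) = t *\<^sub>R v" using r by simp
      then have "q i + t *\<^sub>R v = (1 - t / r) *\<^sub>R q i + (t / r) *\<^sub>R q (i + 1)"
        by (simp add: algebra_simps)
      then have "q i + t *\<^sub>R v \<in> open_segment (q i) (q (i + 1))"
        unfolding in_segment using t r \<open>q i \<noteq> q (i + 1)\<close>
        by (intro conjI exI[of _ "t / r"]) auto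
      then have "q i + t *\<^sub>R v \<notin> K (\<xi> i)"
        using q symbol_spaceD(1)[OF \<xi>] unfolding billiard_orbit_def obstacle_def by blast
      then show "\<exists>t. 0 < t \<and> t < e \<and> q i + t *\<^sub>R v \<notin> K (\<xi> i)" using t by blast
    qed
  qed
  then have un: "u \<bullet> n \<le> 0" using \<open>n \<bullet> n = 1\<close> by (simp add: v inner_diff_left)
  show "critical_reflection (K (\<xi> i)) (q (i - 1)) (q i) (q (i + 1))"
    unfolding critical_reflection_def u_def[symmetric] v_def[symmetric]
  proof
    fix x assume "x \<in> K (\<xi> i)"
    then have "(x - q i) \<bullet> n \<le> 0" using n by (simp add: outer_normal_def)
    then have "(u \<bullet> n) * ((x - q i) \<bullet> n) \<ge> 0" using un by (rule_tac mult_nonpos_nonpos)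
    then show "0 \<le> (u - v) \<bullet> (x - q i)" by (simp add: v inner_commute[of n])
  qed
qed

text \<open>The outer normal is read off from the orbit as the reversed, normalized change of
  direction: criticality makes it supporting, and since both directions are unit vectors they are
  mirror images in the hyperplane orthogonal to it.\<close>

lemma critical_imp_billiard_orbit:
  assumes "critical_orbit \<xi> q"
  shows "billiard_orbit K s \<xi> q"
proof -
  have it: "itinerary \<xi> q" using assms by (simp add: critical_orbit_def)
  define u where "u i = sgn (q (i + 1) - q i)" for i
  define m where "m i = u (i - 1) - u i" for i
  define n where "n i = - sgn (m i)" for i
  have crit: "m i \<bullet> (x - q i) \<ge> 0" if "x \<in> K (\<xi> i)" for x i
    using assms that by (auto simp: critical_orbit_def critical_reflection_def u_def m_def)
  have m0: "m i \<noteq> 0" for i using direction_changes[OF it, of i] by (simp add: u_def m_def)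
  have u1: "norm (u i) = 1" for i using itinerary_neq[OF it, of i] by (auto simp: u_def norm_sgn)
  have um: "u (i - 1) \<bullet> m i = (norm (m i))\<^sup>2 / 2" "u i \<bullet> m i = - (norm (m i))\<^sup>2 / 2" for i
    using norm_diff_unit_vectors_square[OF u1 u1, of "i - 1" i] u1[of i] u1[of "i - 1"]
    by (auto simp: m_def inner_diff_right dot_square_norm inner_commute)
  have n_eq: "n i = (- 1 / norm (m i)) *\<^sub>R m i" for i
    by (simp add: n_def sgn_div_norm divide_inverse)
  have normal: "outer_normal (K (\<xi> i)) (q i) (n i)" for i
    unfolding outer_normal_def
  proof (intro conjI ballI)
    show "norm (n i) = 1" using m0 by (simp add: n_def norm_sgn)
    fix x assume "x \<in> K (\<xi> i)"
    then show "(x - q i) \<bullet> n i \<le> 0"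
      using crit[of x i] by (simp add: n_eq inner_commute divide_nonneg_nonneg)
  qed
  have un: "u (i - 1) \<bullet> n i = - norm (m i) / 2" "u i \<bullet> n i = norm (m i) / 2" for i
    using m0[of i] by (auto simp: n_eq um power2_eq_square)
  have refl: "u i = u (i - 1) - (2 * (u (i - 1) \<bullet> n i)) *\<^sub>R n i" for i
    using m0[of i] unfolding un by (simp add: n_eq m_def[of i])
  have front: "q i \<in> frontier (K (\<xi> i))" for i
  proof -
    have "q i \<notin> interior (K (\<xi> i))"
    proof
      assume "q i \<in> interior (K (\<xi> i))"
      then obtain e where e: "e > 0" "cball (q i) e \<subseteq> K (\<xi> i)" unfolding mem_interior_cball by blast
      have "q i + e *\<^sub>R n i \<in> K (\<xi> i)"
        using e normal[of i] by (intro subsetD[OF e(2)]) (simp add: dist_norm outer_normal_def)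
      then have "(e *\<^sub>R n i) \<bullet> n i \<le> 0" using normal[of i] unfolding outer_normal_def by force
      moreover have "n i \<bullet> n i = 1" using normal[of i] by (simp add: outer_normal_def dot_square_norm)
      ultimately show False using e(1) by simp
    qed
    then show ?thesis using itineraryD(4)[OF it, of i] by (simp add: frontier_def closure_subset[THEN subsetD])
  qed
  have free: "open_segment (q i) (q (i + 1)) \<inter> obstacle K s = {}" for i
  proof -
    \<comment> \<open>The supporting hyperplanes at the two ends exclude the obstacles of the end
      points; no-eclipse excludes all others.\<close>
    have "x \<notin> K k" if x: "x \<in> open_segment (q i) (q (i + 1))" and k: "k \<in> {1..s}" for x k
    proof -
      define r where "r = norm (q (i + 1) - q i)"
      have r: "r > 0" using itinerary_neq[OF it, of i] by (simp add: r_def)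
      have ru: "q (i + 1) - q i = r *\<^sub>R u i" by (simp add: r_def u_def norm_times_sgn)
      obtain t where t: "0 < t" "t < 1" "x = (1 - t) *\<^sub>R q i + t *\<^sub>R q (i + 1)"
        using x unfolding in_segment by blast
      have "x - q i = t *\<^sub>R (q (i + 1) - q i)" using t(3) by (simp add: algebra_simps)
      then have x1: "x - q i = (t * r) *\<^sub>R u i" using ru by simp
      have "x - q (i + 1) = - ((1 - t) *\<^sub>R (q (i + 1) - q i))" using t(3) by (simp add: algebra_simps)
      then have x2: "x - q (i + 1) = - (((1 - t) * r) *\<^sub>R u i)" using ru by simp
      consider "k = \<xi> i" | "k = \<xi> (i + 1)" | "k \<noteq> \<xi> i" "k \<noteq> \<xi> (i + 1)" by blast
      then show ?thesis
      proof cases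
        case 1
        have "(x - q i) \<bullet> n i > 0" using m0[of i] t(1,2) r by (simp add: x1 un(2))
        then show ?thesis using 1 normal[of i] by (auto simp: outer_normal_def)
      next
        case 2
        have "(x - q (i + 1)) \<bullet> n (i + 1) > 0"
          using m0[of "i + 1"] un(1)[of "i + 1"] t(1,2) r by (simp add: x2 mult_pos_neg)
        then show ?thesis using 2 normal[of "i + 1"] by (auto simp: outer_normal_def)
      next
        case 3
        then show ?thesis
          using segment_disjoint_obstacle[OF it k 3] x segment_open_subset_closed by blast
      qed
    qed
    then show ?thesis by (auto simp: obstacle_def)
  qed
  show ?thesis
    unfolding billiard_orbit_def
  proof (intro allI conjI)
    fix i
    show "q i \<in> frontier (K (\<xi> i))" by (rule front)
    show "q i \<noteq> q (i + 1)" by (rule itinerary_neq[OF it])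
    show "open_segment (q i) (q (i + 1)) \<inter> obstacle K s = {}" by (rule free)
    have "sgn (q (i + 1) - q i) = sgn (q i - q (i - 1))
      - (2 * (sgn (q i - q (i - 1)) \<bullet> n i)) *\<^sub>R n i"
      using refl[of i] by (simp add: u_def)
    then show "\<exists>n. outer_normal (K (\<xi> i)) (q i) n \<and> sgn (q (i + 1) - q i) =
        sgn (q i - q (i - 1)) - (2 * (sgn (q i - q (i - 1)) \<bullet> n)) *\<^sub>R n"
      using normal by (intro exI conjI)
  qed
qed

section \<open>Existence of orbits and continuity of \<open>phi\<close>\<close>

lemma phi_eq:
  assumes "critical_orbit \<xi> q"
  shows "phi K s \<xi> = q 0"
proof -
  have \<xi>: "\<xi> \<in> symbol_space s" using assms by (simp add: critical_orbit_def itinerary_def)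
  have uniq: "q' = q" if "billiard_orbit K s \<xi> q'" for q'
    using critical_orbit_unique[OF assms billiard_orbit_imp_critical[OF \<xi> that]] .
  have "(THE yv. \<exists>q. billiard_orbit K s \<xi> q \<and> yv = (q 0, sgn (q 1 - q 0))) = (q 0, sgn (q 1 - q 0))"
  proof (rule the_equality)
    show "\<exists>q'. billiard_orbit K s \<xi> q' \<and> (q 0, sgn (q 1 - q 0)) = (q' 0, sgn (q' 1 - q' 0))"
      using critical_imp_billiard_orbit[OF assms] by (intro exI[of _ q] conjI refl)
    fix yv assume "\<exists>q'. billiard_orbit K s \<xi> q' \<and> yv = (q' 0, sgn (q' 1 - q' 0))"
    then obtain q' where "billiard_orbit K s \<xi> q'" "yv = (q' 0, sgn (q' 1 - q' 0))" by (elim exE conjE)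
    then show "yv = (q 0, sgn (q 1 - q 0))" using uniq[of q'] by simp
  qed
  then show ?thesis by (simp add: phi_def)
qed

text \<open>Minimizing a finite piece of the length gives minimality at every inner bounce of that
  piece. These conditions are closed and grow stronger with the piece, so by compactness one
  sequence satisfies all of them.\<close>

lemma ex_minimal_itinerary:
  assumes \<xi>: "\<xi> \<in> symbol_space s"
  obtains q where "itinerary \<xi> q"
    "\<And>i. minimal_reflection (K (\<xi> i)) (q (i - 1)) (q i) (q (i + 1))"
proof -
  define C where "C = {q. \<forall>i. q i \<in> K (\<xi> i)}"
  have "compact C" unfolding C_def
    by (intro compact_pointwise_constrained_functions obstacles(1) symbol_spaceD(1)[OF \<xi>])
  have "\<exists>q. \<forall>i. q i \<in> K (\<xi> i)" using obstacles(6) symbol_spaceD(1)[OF \<xi>] by (intro choice) blast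
  then have "C \<noteq> {}" by (auto simp: C_def)
  define M where "M n = {q. \<forall>i. \<bar>i\<bar> < int n \<longrightarrow> minimal_reflection (K (\<xi> i)) (q (i - 1)) (q i) (q (i + 1))}" for n
  have M_closed: "closed (M n)" for n
    unfolding M_def minimal_reflection_def Ball_def
    by (intro closed_Collect_all closed_Collect_imp closed_Collect_le continuous_intros
        continuous_on_product_then_coordinatewise) auto
  have M_nonempty: "C \<inter> M n \<noteq> {}" for n
  proof -
    define F where "F q = (\<Sum>i\<in>{- int n..<int n}. dist (q i) (q (i + 1)))" for q :: "int \<Rightarrow> 'a"
    have "continuous_on C F" unfolding F_def
      by (intro continuous_intros continuous_on_product_then_coordinatewise continuous_on_id)
    then obtain q where q: "q \<in> C" "\<And>y. y \<in> C \<Longrightarrow> F q \<le> F y"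
      using continuous_attains_inf[OF \<open>compact C\<close> \<open>C \<noteq> {}\<close>] by blast
    have "dist (q (j - 1)) (q j) + dist (q j) (q (j + 1)) \<le> dist (q (j - 1)) x + dist x (q (j + 1))"
      if j: "\<bar>j\<bar> < int n" and x: "x \<in> K (\<xi> j)" for j x
    proof -
      \<comment> \<open>Moving the point at \<open>j\<close> affects only the terms
        \<open>j - 1\<close> and \<open>j\<close>; the strict bound on \<open>\<bar>j\<bar>\<close>
        ensures that both belong to the sum.\<close>
      define I where "I = {- int n..<int n} - {j - 1, j}"
      have I: "{- int n..<int n} = insert (j - 1) (insert j I)" "finite I" "j - 1 \<notin> insert j I" "j \<notin> I"
        using j by (auto simp: I_def)
      have F: "F y = dist (y (j - 1)) (y j) + (dist (y j) (y (j + 1)) + (\<Sum>i\<in>I. dist (y i) (y (i + 1))))" for y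
        unfolding F_def I(1) using I by (simp del: insert_iff)
      have "q(j := x) \<in> C" using q(1) x by (simp add: C_def)
      then have "F q \<le> F (q(j := x))" by (rule q(2))
      moreover have "(\<Sum>i\<in>I. dist ((q(j := x)) i) ((q(j := x)) (i + 1))) = (\<Sum>i\<in>I. dist (q i) (q (i + 1)))"
        by (intro sum.cong) (auto simp: I_def)
      ultimately show ?thesis unfolding F by simp
    qed
    then have "q \<in> M n" by (auto simp: M_def minimal_reflection_def)
    then show ?thesis using q(1) by blast
  qed
  have "C \<inter> (\<Inter>n\<in>UNIV. M n) \<noteq> {}"
  proof (rule compact_imp_fip_image[OF \<open>compact C\<close> M_closed])
    fix N' :: "nat set" assume "finite N'"
    then obtain n where n: "\<And>m. m \<in> N' \<Longrightarrow> m \<le> n" by (meson Max_ge)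
    have "M n \<subseteq> M m" if "m \<in> N'" for m using n[OF that] by (auto simp: M_def)
    then show "C \<inter> (\<Inter>m\<in>N'. M m) \<noteq> {}" using M_nonempty[of n] by blast
  qed
  then obtain q where q: "q \<in> C" "\<And>n. q \<in> M n" by blast
  have "minimal_reflection (K (\<xi> i)) (q (i - 1)) (q i) (q (i + 1))" for i
    using q(2)[of "nat \<bar>i\<bar> + 1"] by (simp add: M_def)
  then show ?thesis using that q(1) \<xi> by (simp add: itinerary_def C_def)
qed

lemma minimal_itinerary_imp_critical:
  assumes it: "itinerary \<xi> q"
    and "\<And>i. minimal_reflection (K (\<xi> i)) (q (i - 1)) (q i) (q (i + 1))"
  shows "critical_orbit \<xi> q"
  unfolding critical_orbit_def
proof (intro conjI allI it minimal_imp_critical assms(2))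
  fix i
  show "convex (K (\<xi> i))" using obstacles(4) itineraryD(1)[OF it] by blast
  show "q i \<in> K (\<xi> i)" by (rule itineraryD(4)[OF it])
  show "q i \<noteq> q (i - 1)" "q i \<noteq> q (i + 1)"
    using itinerary_neq[OF it, of "i - 1"] itinerary_neq[OF it, of i] by auto
qed

lemma phi_in_obstacle:
  assumes "\<xi> \<in> symbol_space s"
  shows "phi K s \<xi> \<in> K (\<xi> 0)"
proof -
  obtain q where q: "itinerary \<xi> q"
    "\<And>i. minimal_reflection (K (\<xi> i)) (q (i - 1)) (q i) (q (i + 1))"
    using ex_minimal_itinerary[OF assms] by blast
  then show ?thesis
    using phi_eq[OF minimal_itinerary_imp_critical[OF q]] itineraryD(4)[OF q(1), of 0] by simp
qed

text \<open>Compactness upgrades uniqueness of the orbit to uniform dependence on finitely many symbols: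
  pairs of itineraries that are minimal on a window \<open>n\<close> and have starting points at least \<open>e\<close> apart
  form a decreasing family of compact sets with empty intersection.\<close>

lemma phi_window_continuous:
  assumes e: "e > 0"
  shows "\<exists>n::nat. \<forall>\<xi>\<in>symbol_space s. \<forall>\<eta>\<in>symbol_space s.
    (\<forall>i. \<bar>i\<bar> \<le> int n \<longrightarrow> \<xi> i = \<eta> i) \<longrightarrow> norm (phi K s \<xi> - phi K s \<eta>) < e"
proof -
  \<comment> \<open>The symbol is stored with the two bounce points, so that itineraries vary in the
    compact space as well and both orbits share one symbol sequence.\<close>
  define C where "C = {w :: int \<Rightarrow> nat \<times> 'a \<times> 'a. \<forall>i. w i \<in> (\<Union>k\<in>{1..s}. {k} \<times> K k \<times> K k)}"
  define x y where "x w i = fst (snd (w i))" and "y w i = snd (snd (w i))"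
    for w :: "int \<Rightarrow> nat \<times> 'a \<times> 'a" and i
  \<comment> \<open>Naming the symbol by a quantified \<open>k\<close> makes each condition an
    implication with an open premise and a closed conclusion for a fixed obstacle, hence
    closed.\<close>
  define M where "M n = {w. norm (x w 0 - y w 0) \<ge> e \<and> (\<forall>i. fst (w i) \<noteq> fst (w (i + 1))) \<and>
    (\<forall>i k. \<bar>i\<bar> < int n \<and> fst (w i) = k \<longrightarrow>
      minimal_reflection (K k) (x w (i - 1)) (x w i) (x w (i + 1)) \<and>
      minimal_reflection (K k) (y w (i - 1)) (y w i) (y w (i + 1)))}" for n
  have "compact C" unfolding C_def
    by (intro compact_pointwise_constrained_functions compact_UN compact_Times obstacles(1)) auto
  have cont: "continuous_on UNIV (\<lambda>w::int \<Rightarrow> nat \<times> 'a \<times> 'a. w i)" for i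
    by simp
  have M_closed: "closed (M n)" for n
  proof -
    have op: "open {w :: int \<Rightarrow> nat \<times> 'a \<times> 'a. fst (w i) = k}" for i k
    proof -
      have "open ((\<lambda>w :: int \<Rightarrow> nat \<times> 'a \<times> 'a. fst (w i)) -` {k})"
        by (intro open_vimage continuous_intros cont) (simp add: open_discrete)
      then show ?thesis by (simp add: vimage_def)
    qed
    have op2: "open {w :: int \<Rightarrow> nat \<times> 'a \<times> 'a. fst (w i) = fst (w j)}" for i j
    proof -
      have "{w :: int \<Rightarrow> nat \<times> 'a \<times> 'a. fst (w i) = fst (w j)} = (\<Union>k. {w. fst (w i) = k} \<inter> {w. fst (w j) = k})"
        by auto
      also have "open \<dots>" by (intro open_UN ballI open_Int op)
      finally show ?thesis .
    qed
    show ?thesis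
      unfolding M_def minimal_reflection_def Ball_def x_def y_def
      by (intro closed_Collect_conj closed_Collect_all closed_Collect_imp closed_Collect_le closed_Collect_neg
          open_Collect_conj continuous_intros cont op op2) auto
  qed
  have "\<exists>n. C \<inter> M n = {}"
  proof (rule ccontr)
    assume "\<nexists>n. C \<inter> M n = {}"
    then have M_nonempty: "C \<inter> M n \<noteq> {}" for n by blast
    have "C \<inter> (\<Inter>n\<in>UNIV. M n) \<noteq> {}"
    proof (rule compact_imp_fip_image[OF \<open>compact C\<close> M_closed])
      fix N' :: "nat set" assume "finite N'"
      then obtain n where n: "\<And>m. m \<in> N' \<Longrightarrow> m \<le> n" by (meson Max_ge)
      have "M n \<subseteq> M m" if "m \<in> N'" for m using n[OF that] unfolding M_def by fastforce
      then show "C \<inter> (\<Inter>m\<in>N'. M m) \<noteq> {}" using M_nonempty[of n] by blast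
    qed
    then obtain w where w: "w \<in> C" "\<And>n. w \<in> M n" by blast
    define \<xi> where "\<xi> i = fst (w i)" for i
    have sym: "\<xi> i \<in> {1..s}" "x w i \<in> K (\<xi> i)" "y w i \<in> K (\<xi> i)" for i
    proof -
      have "w i \<in> (\<Union>k\<in>{1..s}. {k} \<times> K k \<times> K k)" using w(1) unfolding C_def by blast
      then show "\<xi> i \<in> {1..s}" "x w i \<in> K (\<xi> i)" "y w i \<in> K (\<xi> i)"
        by (auto simp: \<xi>_def x_def y_def)
    qed
    have "\<xi> i \<noteq> \<xi> (i + 1)" for i using w(2)[of 0] by (simp add: M_def \<xi>_def)
    then have "\<xi> \<in> symbol_space s" using sym(1) by (simp add: symbol_space_def)
    then have it: "itinerary \<xi> (x w)" "itinerary \<xi> (y w)" using sym by (auto simp: itinerary_def)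
    have "minimal_reflection (K (\<xi> i)) (x w (i - 1)) (x w i) (x w (i + 1))"
      "minimal_reflection (K (\<xi> i)) (y w (i - 1)) (y w i) (y w (i + 1))" for i
      using w(2)[of "nat \<bar>i\<bar> + 1"] by (auto simp: M_def \<xi>_def)
    then have "x w = y w"
      using it by (intro critical_orbit_unique minimal_itinerary_imp_critical)
    then show False using w(2)[of 0] e by (simp add: M_def)
  qed
  then obtain n where n: "C \<inter> M n = {}" by blast
  have "norm (phi K s \<xi> - phi K s \<eta>) < e"
    if \<xi>: "\<xi> \<in> symbol_space s" and \<eta>: "\<eta> \<in> symbol_space s" and eq: "\<And>i. \<bar>i\<bar> \<le> int n \<Longrightarrow> \<xi> i = \<eta> i" for \<xi> \<eta>
  proof (rule ccontr)
    assume ge: "\<not> norm (phi K s \<xi> - phi K s \<eta>) < e"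
    obtain p where p: "itinerary \<xi> p" "\<And>i. minimal_reflection (K (\<xi> i)) (p (i - 1)) (p i) (p (i + 1))"
      using ex_minimal_itinerary[OF \<xi>] by blast
    obtain q where q: "itinerary \<eta> q" "\<And>i. minimal_reflection (K (\<eta> i)) (q (i - 1)) (q i) (q (i + 1))"
      using ex_minimal_itinerary[OF \<eta>] by blast
    have ge': "norm (p 0 - q 0) \<ge> e"
      using ge by (simp add: phi_eq[OF minimal_itinerary_imp_critical[OF p]] phi_eq[OF minimal_itinerary_imp_critical[OF q]])
    \<comment> \<open>Beyond the window the symbols may differ, so \<open>r\<close> falls back on
      \<open>p\<close> to stay in the obstacles of \<open>\<xi>\<close>. Minimality for
      \<open>\<bar>i\<bar> < int n\<close> involves only points with
      \<open>\<bar>i\<bar> \<le> int n\<close>, where \<open>r\<close> is \<open>q\<close>.\<close>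
    define r where "r i = (if \<bar>i\<bar> \<le> int n then q i else p i)" for i
    define w where "w i = (\<xi> i, p i, r i)" for i
    have rK: "r i \<in> K (\<xi> i)" for i
      using itineraryD(4)[OF p(1)] itineraryD(4)[OF q(1)] eq[of i] by (auto simp: r_def)
    then have "w \<in> C"
      using itineraryD(1,4)[OF p(1)] by (auto simp: C_def w_def)
    moreover have "minimal_reflection (K (\<xi> i)) (r (i - 1)) (r i) (r (i + 1))" if "\<bar>i\<bar> < int n" for i
    proof -
      have "r (i - 1) = q (i - 1)" "r i = q i" "r (i + 1) = q (i + 1)" "\<xi> i = \<eta> i"
        using that by (auto simp: r_def intro: eq)
      then show ?thesis using q(2)[of i] by simp
    qed
    then have "w \<in> M n"
      using ge' p(2) itineraryD(2)[OF p(1)] by (auto simp: M_def w_def x_def y_def r_def)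
    ultimately show False using n by blast
  qed
  then show ?thesis by blast
qed

end

theorem theorem1:
  fixes K :: "nat \<Rightarrow> 'a::euclidean_space set" and s :: nat
  assumes "DIM('a) \<ge> 2" and "s \<ge> 3" and "open_billiard K s"
  shows "convex (general_rotation_set (phi K s) (symbol_space s)) \<and>
         periodic_rotation_set (phi K s) (symbol_space s)
           \<subseteq> general_rotation_set (phi K s) (symbol_space s) \<and>
         general_rotation_set (phi K s) (symbol_space s)
           \<subseteq> closure (periodic_rotation_set (phi K s) (symbol_space s))"
proof -
  interpret open_billiard_table K s by unfold_locales (rule assms(3))
  obtain B where B: "B > 0" "\<And>i x. i \<in> {1..s} \<Longrightarrow> x \<in> K i \<Longrightarrow> norm x \<le> B"
    using obstacle_bounded by blast
  interpret window_continuous_observable "phi K s" s B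
  proof
    show "norm (phi K s \<xi>) \<le> B" if "\<xi> \<in> symbol_space s" for \<xi>
      using B(2) phi_in_obstacle[OF that] symbol_spaceD(1)[OF that] by blast
  qed (use assms(2) B(1) phi_window_continuous in auto)
  show ?thesis by (rule rotation_set_structure)
qed

end
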